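(* Let $F:\mathbb{R}^n\rightrightarrows\mathbb{R}^n$ satisfy assumption (F), let $\mathcal{K}\subset\mathbb{R}^n$ be closed, and let $\mathcal{T}$ be the minimum time function associated with $F$ and $\mathcal{K}$. (a) If $x_0\in\mathcal{K}$, then $$\partial^{\infty}\mathcal{T}(x_0)=N^P_{\mathcal{K}}(x_0)\cap\{\zeta\in\mathbb{R}^n: h(x_0,\zeta)\ge 0\}.$$ (b) If $x_0\in\mathcal{R}\setminus\mathcal{K}$, then $$\partial^{\infty}\mathcal{T}(x_0)=N^P_{\mathcal{R}(\mathcal{T}(x_0))}(x_0)\cap\{\zeta\in\mathbb{R}^n: h(x_0,\zeta)=0\}.$$
   Context: Assumption (F) on a multifunction $F:\mathbb{R}^n\rightrightarrows\mathbb{R}^n$: (F1) $F(x)$ is nonempty, convex and compact for each $x\in\mathbb{R}^n$; (F2) for each compact $Q\subset\mathbb{R}^n$ there is $L>0$ with $F(x)\subset F(y)+L|y-x|\bar{\mathbb{B}}$ for all $x,y\in Q$, where $\bar{\mathbb{B}}$ is the closed unit ball; (F3) there is $\gamma>0$ with $\max\{|v|:v\in F(x)\}\le\gamma(1+|x|)$ for all $x\in\mathbb{R}^n$. A trajectory of $F$ starting at $x$ is an absolutely continuous $x(\cdot)$ on $[0,T]$ with $\dot x(t)\in F(x(t))$ for a.e. $t$ and $x(0)=x$. The minimum time function $\mathcal{T}:\mathbb{R}^n\to[0,+\infty]$ associated with the closed target $\mathcal{K}$ is $\mathcal{T}(x)=0$ if $x\in\mathcal{K}$, and otherwise $\mathcal{T}(x)=\inf\{T>0:\text{there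 is a trajectory } x(\cdot) \text{ of } F \text{ with } x(0)=x,\ x(T)\in\mathcal{K}\}$, with $\inf\emptyset=+\infty$. The controllable set is $\mathcal{R}=\{x:\mathcal{T}(x)<+\infty\}$, and for $t\ge0$, $\mathcal{R}(t)=\{x:\mathcal{T}(x)\le t\}$ (so $\mathcal{R}(0)=\mathcal{K}$). Minimized Hamiltonian: $h(x,\zeta)=\min_{v\in F(x)}\langle v,\zeta\rangle$. For a closed set $E$ and $x\in E$, the proximal normal cone $N^P_E(x)$ is the set of $v$ for which there is $\sigma\ge0$ with $\langle v,y-x\rangle\le\sigma|y-x|^2$ for all $y\in E$. The epigraph is $\mathrm{epi}(\mathcal{T})=\{(x,\beta)\in\mathbb{R}^n\times\mathbb{R}:\mathcal{T}(x)<+\infty,\ \beta\ge\mathcal{T}(x)\}$. The horizontal proximal subdifferential is $\partial^\infty\mathcal{T}(x)=\{v\in\mathbb{R}^n:(v,0)\in N^P_{\mathrm{epi}(\mathcal{T})}(x,\mathcal{T}(x))\}$. *)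

theory Defs
  imports "HOL-Analysis.Analysis"
begin

definition F1 :: "('a::euclidean_space \<Rightarrow> 'a set) \<Rightarrow> bool" where
  "F1 F \<longleftrightarrow> (\<forall>x. F x \<noteq> {} \<and> convex (F x) \<and> compact (F x))"

definition F2 :: "('a::euclidean_space \<Rightarrow> 'a set) \<Rightarrow> bool" where
  "F2 F \<longleftrightarrow> (\<forall>Q. compact Q \<longrightarrow>
     (\<exists>L>0. \<forall>x\<in>Q. \<forall>y\<in>Q. F x \<subseteq> {v + (L * norm (y - x)) *\<^sub>R b | v b. v \<in> F y \<and> b \<in> cball 0 1}))"

definition F3 :: "('a::euclidean_space \<Rightarrow> 'a set) \<Rightarrow> bool" where
  "F3 F \<longleftrightarrow> (\<exists>\<gamma>>0. \<forall>x. \<forall>v\<in>F x. norm v \<le> \<gamma> * (1 + norm x))"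

definition assumption_F :: "('a::euclidean_space \<Rightarrow> 'a set) \<Rightarrow> bool" where
  "assumption_F F \<longleftrightarrow> F1 F \<and> F2 F \<and> F3 F"

text \<open>The usual epsilon-delta notion for functions on a real interval; HOL-Analysis only has
  absolute continuity of measures.\<close>

definition absolutely_continuous_fun_on :: "real set \<Rightarrow> (real \<Rightarrow> 'a::real_normed_vector) \<Rightarrow> bool" where
  "absolutely_continuous_fun_on S f \<longleftrightarrow>
     (\<forall>\<epsilon>>0. \<exists>\<delta>>0. \<forall>(n::nat) a b.
        (\<forall>i<n. a i \<le> b i \<and> {a i..b i} \<subseteq> S) \<and>
        disjoint_family_on (\<lambda>i. {a i<..<b i}) {..<n} \<and>
        (\<Sum>i<n. b i - a i) < \<delta>
        \<longrightarrow> (\<Sum>i<n. norm (f (b i) - f (a i))) < \<epsilon>)"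

text \<open>Only the values of \<open>x\<close> on \<open>{0..T}\<close> matter, since the derivative is taken within that interval.\<close>

definition trajectory ::
  "('a::euclidean_space \<Rightarrow> 'a set) \<Rightarrow> real \<Rightarrow> 'a \<Rightarrow> (real \<Rightarrow> 'a) \<Rightarrow> bool" where
  "trajectory F T x0 x \<longleftrightarrow>
     absolutely_continuous_fun_on {0..T} x \<and>
     (AE t in lebesgue_on {0..T}. \<exists>v\<in>F (x t). (x has_vector_derivative v) (at t within {0..T})) \<and>
     x 0 = x0"

definition min_time ::
  "('a::euclidean_space \<Rightarrow> 'a set) \<Rightarrow> 'a set \<Rightarrow> 'a \<Rightarrow> ereal" where
  "min_time F K x0 =
     (if x0 \<in> K then 0
      else Inf {ereal T | T. T > 0 \<and> (\<exists>x. trajectory F T x0 x \<and> x T \<in> K)})"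

definition controllable_set ::
  "('a::euclidean_space \<Rightarrow> 'a set) \<Rightarrow> 'a set \<Rightarrow> 'a set" where
  "controllable_set F K = {x. min_time F K x < \<infinity>}"

definition reachable_within ::
  "('a::euclidean_space \<Rightarrow> 'a set) \<Rightarrow> 'a set \<Rightarrow> ereal \<Rightarrow> 'a set" where
  "reachable_within F K t = {x. min_time F K x \<le> t}"

text \<open>For a nonempty compact \<open>F x\<close> the infimum is a minimum, as confirmed below.\<close>

definition min_hamiltonian ::
  "('a::euclidean_space \<Rightarrow> 'a set) \<Rightarrow> 'a \<Rightarrow> 'a \<Rightarrow> real" where
  "min_hamiltonian F x \<zeta> = (INF v\<in>F x. v \<bullet> \<zeta>)"

lemma min_hamiltonian_is_minimum:
  assumes "F1 F"
  shows "\<exists>v\<in>F x. min_hamiltonian F x \<zeta> = v \<bullet> \<zeta> \<and> (\<forall>w\<in>F x. v \<bullet> \<zeta> \<le> w \<bullet> \<zeta>)"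
proof -
  have "compact (F x)" "F x \<noteq> {}" using assms by (auto simp: F1_def)
  moreover have "continuous_on (F x) (\<lambda>v. v \<bullet> \<zeta>)" by (intro continuous_intros)
  ultimately obtain v where v: "v \<in> F x" "\<forall>w\<in>F x. v \<bullet> \<zeta> \<le> w \<bullet> \<zeta>"
    using continuous_attains_inf by blast
  then have "(INF w\<in>F x. w \<bullet> \<zeta>) = v \<bullet> \<zeta>"
    by (intro cInf_eq_minimum) auto
  with v show ?thesis by (auto simp: min_hamiltonian_def)
qed

definition proximal_normal_cone :: "'a::real_inner set \<Rightarrow> 'a \<Rightarrow> 'a set" where
  "proximal_normal_cone E x = {v. \<exists>\<sigma>\<ge>0. \<forall>y\<in>E. v \<bullet> (y - x) \<le> \<sigma> * (norm (y - x))\<^sup>2}"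

definition epi :: "('a \<Rightarrow> ereal) \<Rightarrow> ('a \<times> real) set" where
  "epi f = {(x, \<beta>). f x < \<infinity> \<and> f x \<le> ereal \<beta>}"

text \<open>Meaningful only at points where \<open>f x\<close> is finite.\<close>

definition horizontal_proximal_subdifferential ::
  "('a::euclidean_space \<Rightarrow> ereal) \<Rightarrow> 'a \<Rightarrow> 'a set" where
  "horizontal_proximal_subdifferential f x =
     {v. (v, 0) \<in> proximal_normal_cone (epi f) (x, real_of_ereal (f x))}"

end

theory Submission
  imports Defs
begin

text \<open>Write \<open>r\<close> for the minimum time at \<open>x0\<close>. Both parts follow from one identity: the horizontal
  subdifferential at \<open>x0\<close> consists of the \<open>\<zeta>\<close> in the proximal normal cone of the sublevel set
  \<open>min_time F K y \<le> r\<close> with \<open>h(x0, \<zeta>) \<ge> 0\<close>; and if \<open>r > 0\<close>, such \<open>\<zeta>\<close> in the subdifferential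
  also satisfy \<open>h(x0, \<zeta>) \<le> 0\<close>.

  Normality is the restriction of the epigraph inequality to height \<open>r\<close>. For \<open>h \<ge> 0\<close>, every
  \<open>v \<in> F x0\<close> is the terminal velocity of a trajectory ending at \<open>x0\<close>, along which the minimum time
  exceeds \<open>r\<close> by at most the time left. For \<open>h \<le> 0\<close>, one runs for time \<open>t\<close> along a trajectory whose
  total time exceeds \<open>r\<close> by at most \<open>t\<^sup>2\<close>, so that optimal trajectories need not exist. Conversely,
  from a point \<open>y\<close> whose minimum time is slightly above \<open>r\<close>, a nearly optimal trajectory enters the
  sublevel set after a time comparable to the excess, and until then its velocity \<open>v\<close> satisfies
  \<open>v \<bullet> \<zeta> \<ge> - O(distance to x0)\<close> because \<open>h(x0, \<zeta>) \<ge> 0\<close> and \<open>F\<close> is Lipschitz.\<close>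

subsection \<open>Absolutely continuous functions\<close>

text \<open>The definition numbers the intervals \<open>0, ..., n - 1\<close>. A bijection carries
  it over to any finite index set, in particular to the tagged intervals of a division.\<close>

lemma absolutely_continuous_fun_on_finite:
  assumes "absolutely_continuous_fun_on S f" "\<epsilon> > 0"
  shows "\<exists>\<delta>>0. \<forall>(I :: 'i set) a b. finite I \<longrightarrow> (\<forall>i\<in>I. a i \<le> b i \<and> {a i..b i} \<subseteq> S)
      \<longrightarrow> disjoint_family_on (\<lambda>i. {a i<..<b i}) I \<longrightarrow> (\<Sum>i\<in>I. b i - a i) < \<delta>
      \<longrightarrow> (\<Sum>i\<in>I. norm (f (b i) - f (a i))) < \<epsilon>"
proof -
  obtain \<delta> where "\<delta> > 0" and \<delta>: "\<And>(n::nat) a b.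
        (\<forall>i<n. a i \<le> b i \<and> {a i..b i} \<subseteq> S) \<and>
        disjoint_family_on (\<lambda>i. {a i<..<b i}) {..<n} \<and>
        (\<Sum>i<n. b i - a i) < \<delta>
        \<longrightarrow> (\<Sum>i<n. norm (f (b i) - f (a i))) < \<epsilon>"
    using assms unfolding absolutely_continuous_fun_on_def by blast
  show ?thesis
  proof (intro exI[of _ \<delta>] conjI[OF \<open>\<delta> > 0\<close>] allI impI)
    fix I :: "'i set" and a b :: "'i \<Rightarrow> real"
    assume I: "finite I" "\<forall>i\<in>I. a i \<le> b i \<and> {a i..b i} \<subseteq> S"
        "disjoint_family_on (\<lambda>i. {a i<..<b i}) I" "(\<Sum>i\<in>I. b i - a i) < \<delta>"
    obtain h where h: "bij_betw h {..<card I} I"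
      using ex_bij_betw_nat_finite[OF I(1)] by (auto simp: atLeast0LessThan)
    have sum: "(\<Sum>i<card I. g (h i)) = sum g I" for g :: "'i \<Rightarrow> real"
      by (rule sum.reindex_bij_betw[OF h])
    have hI: "h i \<in> I" if "i < card I" for i
      using h that by (auto simp: bij_betw_def)
    have "disjoint_family_on (\<lambda>i. {a (h i)<..<b (h i)}) {..<card I}"
      unfolding disjoint_family_on_def
    proof (intro ballI impI)
      fix m n assume "m \<in> {..<card I}" "n \<in> {..<card I}" "m \<noteq> n"
      then have "h m \<noteq> h n" "h m \<in> I" "h n \<in> I"
        using h hI by (auto simp: bij_betw_def inj_on_def)
      then show "{a (h m)<..<b (h m)} \<inter> {a (h n)<..<b (h n)} = {}"
        using I(3) by (auto simp: disjoint_family_on_def)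
    qed
    then show "(\<Sum>i\<in>I. norm (f (b i) - f (a i))) < \<epsilon>"
      using \<delta>[of "card I" "a \<circ> h" "b \<circ> h"] I(2,4) hI
        sum[of "\<lambda>i. norm (f (b i) - f (a i))"] sum[of "\<lambda>i. b i - a i"]
      by (simp add: o_def)
  qed
qed

lemma absolutely_continuous_fun_on_subset:
  "absolutely_continuous_fun_on S f \<Longrightarrow> S' \<subseteq> S \<Longrightarrow> absolutely_continuous_fun_on S' f"
  unfolding absolutely_continuous_fun_on_def by (meson order_trans)

lemma absolutely_continuous_fun_on_add:
  assumes "absolutely_continuous_fun_on S f" "absolutely_continuous_fun_on S g"
  shows "absolutely_continuous_fun_on S (\<lambda>t. f t + g t)"
  unfolding absolutely_continuous_fun_on_def
proof (intro allI impI)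
  fix \<epsilon> :: real assume "\<epsilon> > 0"
  then have "\<epsilon>/2 > 0" by simp
  obtain d1 where d1: "d1 > 0" "\<And>(n::nat) a b.
        (\<forall>i<n. a i \<le> b i \<and> {a i..b i} \<subseteq> S) \<and>
        disjoint_family_on (\<lambda>i. {a i<..<b i}) {..<n} \<and>
        (\<Sum>i<n. b i - a i) < d1
        \<longrightarrow> (\<Sum>i<n. norm (f (b i) - f (a i))) < \<epsilon>/2"
    using assms(1) \<open>\<epsilon>/2 > 0\<close> unfolding absolutely_continuous_fun_on_def by blast
  obtain d2 where d2: "d2 > 0" "\<And>(n::nat) a b.
        (\<forall>i<n. a i \<le> b i \<and> {a i..b i} \<subseteq> S) \<and>
        disjoint_family_on (\<lambda>i. {a i<..<b i}) {..<n} \<and>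
        (\<Sum>i<n. b i - a i) < d2
        \<longrightarrow> (\<Sum>i<n. norm (g (b i) - g (a i))) < \<epsilon>/2"
    using assms(2) \<open>\<epsilon>/2 > 0\<close> unfolding absolutely_continuous_fun_on_def by blast
  have "(\<Sum>i<n. norm (f (b i) + g (b i) - (f (a i) + g (a i)))) < \<epsilon>"
    if "(\<forall>i<n. a i \<le> b i \<and> {a i..b i} \<subseteq> S) \<and>
        disjoint_family_on (\<lambda>i. {a i<..<b i}) {..<n} \<and>
        (\<Sum>i<n. b i - a i) < min d1 d2" for n :: nat and a b
  proof -
    have "(\<Sum>i<n. norm (f (b i) + g (b i) - (f (a i) + g (a i))))
        \<le> (\<Sum>i<n. norm (f (b i) - f (a i)) + norm (g (b i) - g (a i)))"
      by (intro sum_mono) (metis add_diff_add norm_triangle_ineq)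
    also have "\<dots> < \<epsilon>/2 + \<epsilon>/2"
      unfolding sum.distrib using d1(2)[of n a b] d2(2)[of n a b] that by (intro add_strict_mono) auto
    finally show ?thesis by simp
  qed
  then show "\<exists>\<delta>>0. \<forall>(n::nat) a b.
        (\<forall>i<n. a i \<le> b i \<and> {a i..b i} \<subseteq> S) \<and>
        disjoint_family_on (\<lambda>i. {a i<..<b i}) {..<n} \<and>
        (\<Sum>i<n. b i - a i) < \<delta>
        \<longrightarrow> (\<Sum>i<n. norm (f (b i) + g (b i) - (f (a i) + g (a i)))) < \<epsilon>"
    using d1(1) d2(1) by (intro exI[of _ "min d1 d2"]) auto
qed

text \<open>A monotone map that does not stretch time sends non-overlapping intervals to
  non-overlapping, possibly degenerate, intervals of no larger total length. It covers time shifts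
  and the clamped times \<open>min t s\<close> and \<open>max (t - s) 0\<close> that occur when
  trajectories are cut and joined.\<close>

lemma absolutely_continuous_fun_on_compose:
  fixes g :: "real \<Rightarrow> real"
  assumes f: "absolutely_continuous_fun_on S f" and g: "mono g"
    and lip: "\<And>s t. s \<le> t \<Longrightarrow> g t - g s \<le> t - s"
    and S: "\<And>s t. {s..t} \<subseteq> S' \<Longrightarrow> s \<le> t \<Longrightarrow> {g s..g t} \<subseteq> S"
  shows "absolutely_continuous_fun_on S' (\<lambda>t. f (g t))"
  unfolding absolutely_continuous_fun_on_def
proof (intro allI impI)
  fix \<epsilon> :: real assume "\<epsilon> > 0"
  obtain \<delta> where d: "\<delta> > 0" "\<And>(n::nat) a b.
        (\<forall>i<n. a i \<le> b i \<and> {a i..b i} \<subseteq> S) \<and>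
        disjoint_family_on (\<lambda>i. {a i<..<b i}) {..<n} \<and>
        (\<Sum>i<n. b i - a i) < \<delta>
        \<longrightarrow> (\<Sum>i<n. norm (f (b i) - f (a i))) < \<epsilon>"
    using f \<open>\<epsilon> > 0\<close> unfolding absolutely_continuous_fun_on_def by blast
  have "(\<Sum>i<n. norm (f (g (b i)) - f (g (a i)))) < \<epsilon>"
    if *: "(\<forall>i<n. a i \<le> b i \<and> {a i..b i} \<subseteq> S') \<and>
        disjoint_family_on (\<lambda>i. {a i<..<b i}) {..<n} \<and>
        (\<Sum>i<n. b i - a i) < \<delta>" for n :: nat and a b
  proof -
    have "(\<Sum>i<n. g (b i) - g (a i)) \<le> (\<Sum>i<n. b i - a i)"
      by (intro sum_mono lip) (use * in auto)
    moreover have "disjoint_family_on (\<lambda>i. {g (a i)<..<g (b i)}) {..<n}"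
      unfolding disjoint_family_on_def
    proof (intro ballI impI)
      fix i j assume ij: "i \<in> {..<n}" "j \<in> {..<n}" "i \<noteq> j"
      then have "{a i<..<b i} \<inter> {a j<..<b j} = {}" "a i \<le> b i" "a j \<le> b j"
        using * by (auto simp: disjoint_family_on_def)
      \<comment> \<open>Disjointness of open intervals is first turned into inequalities between end
        points, because these survive a map that is only weakly monotone.\<close>
      then have "a i = b i \<or> a j = b j \<or> b i \<le> a j \<or> b j \<le> a i"
        by (auto simp: Int_greaterThanLessThan min_def max_def split: if_splits)
      then show "{g (a i)<..<g (b i)} \<inter> {g (a j)<..<g (b j)} = {}"
        using g by (auto dest: monoD[OF g])
    qed
    ultimately show ?thesis
      using d(2)[of n "\<lambda>i. g (a i)" "\<lambda>i. g (b i)"] * S monoD[OF g] by (meson order_le_less_trans)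
  qed
  then show "\<exists>\<delta>>0. \<forall>(n::nat) a b.
        (\<forall>i<n. a i \<le> b i \<and> {a i..b i} \<subseteq> S') \<and>
        disjoint_family_on (\<lambda>i. {a i<..<b i}) {..<n} \<and>
        (\<Sum>i<n. b i - a i) < \<delta>
        \<longrightarrow> (\<Sum>i<n. norm (f (g (b i)) - f (g (a i)))) < \<epsilon>"
    using d(1) by blast
qed

lemma lipschitz_on_imp_absolutely_continuous_fun_on:
  assumes "M-lipschitz_on S f"
  shows "absolutely_continuous_fun_on S f"
  unfolding absolutely_continuous_fun_on_def
proof (intro allI impI)
  fix \<epsilon> :: real assume "\<epsilon> > 0"
  have M: "M \<ge> 0" using assms by (rule lipschitz_on_nonneg)
  \<comment> \<open>Dividing by \<open>M + 1\<close> instead of \<open>M\<close> includes the case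
    \<open>M = 0\<close>.\<close>
  have "(\<Sum>i<n. norm (f (b i) - f (a i))) < \<epsilon>"
    if *: "(\<forall>i<n. a i \<le> b i \<and> {a i..b i} \<subseteq> S) \<and>
        disjoint_family_on (\<lambda>i. {a i<..<b i}) {..<n} \<and>
        (\<Sum>i<n. b i - a i) < \<epsilon> / (M + 1)" for n :: nat and a b
  proof -
    have "norm (f (b i) - f (a i)) \<le> M * (b i - a i)" if "i < n" for i
    proof -
      have "a i \<le> b i" "{a i..b i} \<subseteq> S" using * that by auto
      then have "a i \<in> S" "b i \<in> S" by auto
      then show ?thesis
        using lipschitz_onD[OF assms, of "b i" "a i"] \<open>a i \<le> b i\<close> by (simp add: dist_norm)
    qed
    then have "(\<Sum>i<n. norm (f (b i) - f (a i))) \<le> M * (\<Sum>i<n. b i - a i)"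
      unfolding sum_distrib_left by (intro sum_mono) auto
    also have "\<dots> \<le> (M + 1) * (\<Sum>i<n. b i - a i)"
      using * by (intro mult_right_mono sum_nonneg) auto
    also have "\<dots> < \<epsilon>" using * M by (simp add: field_simps)
    finally show ?thesis .
  qed
  then show "\<exists>\<delta>>0. \<forall>(n::nat) a b.
        (\<forall>i<n. a i \<le> b i \<and> {a i..b i} \<subseteq> S) \<and>
        disjoint_family_on (\<lambda>i. {a i<..<b i}) {..<n} \<and>
        (\<Sum>i<n. b i - a i) < \<delta>
        \<longrightarrow> (\<Sum>i<n. norm (f (b i) - f (a i))) < \<epsilon>"
    using \<open>\<epsilon> > 0\<close> M by (intro exI[of _ "\<epsilon> / (M + 1)"]) auto
qed

lemma absolutely_continuous_fun_on_imp_continuous_on: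
  assumes "absolutely_continuous_fun_on {a..b} f"
  shows "continuous_on {a..b} f"
  unfolding continuous_on_iff
proof (intro ballI allI impI)
  fix t e assume t: "t \<in> {a..b}" and "(e::real) > 0"
  obtain \<delta> where d: "\<delta> > 0" "\<forall>(I :: unit set) u v. finite I
        \<longrightarrow> (\<forall>i\<in>I. u i \<le> v i \<and> {u i..v i} \<subseteq> {a..b})
        \<longrightarrow> disjoint_family_on (\<lambda>i. {u i<..<v i}) I \<longrightarrow> (\<Sum>i\<in>I. v i - u i) < \<delta>
        \<longrightarrow> (\<Sum>i\<in>I. norm (f (v i) - f (u i))) < e"
    using absolutely_continuous_fun_on_finite[OF assms \<open>e > 0\<close>] by (elim exE conjE)
  have "dist (f s) (f t) < e" if s: "s \<in> {a..b}" "dist s t < \<delta>" for s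
  proof -
    have "norm (f (max s t) - f (min s t)) < e"
    using d(2)[rule_format, of "{()}" "\<lambda>_. min s t" "\<lambda>_. max s t"] s t
      by (auto simp: disjoint_family_on_def dist_norm)
    then show ?thesis
      by (cases "s \<le> t") (simp_all add: dist_norm norm_minus_commute)
  qed
  then show "\<exists>d>0. \<forall>s\<in>{a..b}. dist s t < d \<longrightarrow> dist (f s) (f t) < e"
    using d(1) by blast
qed

section \<open>Increments of absolutely continuous functions from bounds on the derivative\<close>

lemma tagged_partial_division_length_le:
  fixes U :: "real set"
  assumes q: "q tagged_partial_division_of S" and U: "U \<in> lmeasurable"
    and sub: "\<And>x k. (x, k) \<in> q \<Longrightarrow> k \<subseteq> U"
  shows "(\<Sum>i\<in>q. Sup (snd i) - Inf (snd i)) \<le> measure lebesgue U"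
    and "disjoint_family_on (\<lambda>i. {Inf (snd i)<..<Sup (snd i)}) q"
    and "\<And>i. i \<in> q \<Longrightarrow> Inf (snd i) \<le> Sup (snd i) \<and> {Inf (snd i)..Sup (snd i)} = snd i"
proof -
  show iv: "Inf (snd i) \<le> Sup (snd i) \<and> {Inf (snd i)..Sup (snd i)} = snd i" if iq: "i \<in> q" for i
  proof -
    obtain x k where i: "i = (x, k)" by force
    then obtain c d where "k = {c..d}" "x \<in> k"
      using tagged_partial_division_ofD(2,4)[OF q] iq by (metis box_real(2))
    then show ?thesis by (simp add: i)
  qed
  have int: "interior (snd i) = {Inf (snd i)<..<Sup (snd i)}" if "i \<in> q" for i
    using iv[OF that] by (metis interior_atLeastAtMost_real)
  show disj: "disjoint_family_on (\<lambda>i. {Inf (snd i)<..<Sup (snd i)}) q"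
    unfolding disjoint_family_on_def
  proof (intro ballI impI)
    fix i j assume ij: "i \<in> q" "j \<in> q" "i \<noteq> j"
    then have "interior (snd i) \<inter> interior (snd j) = {}"
      using tagged_partial_division_ofD(5)[OF q, of "fst i" "snd i" "fst j" "snd j"] by auto
    then show "{Inf (snd i)<..<Sup (snd i)} \<inter> {Inf (snd j)<..<Sup (snd j)} = {}"
      using int ij by simp
  qed
  have fin: "finite q" using q tagged_partial_division_ofD(1) by blast
  \<comment> \<open>The interiors are pairwise disjoint, so the lengths add up to the measure of
    their union, which lies in \<open>U\<close>.\<close>
  have "(\<Sum>i\<in>q. Sup (snd i) - Inf (snd i)) = (\<Sum>i\<in>q. measure lebesgue {Inf (snd i)<..<Sup (snd i)})"
    by (intro sum.cong) (use iv in auto)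
  also have "\<dots> = measure lebesgue (\<Union>i\<in>q. {Inf (snd i)<..<Sup (snd i)})"
    by (rule measure_negligible_finite_Union_image[symmetric, OF fin])
      (use disj in \<open>auto simp: pairwise_def disjoint_family_on_def\<close>)
  also have "\<dots> \<le> measure lebesgue U"
  proof (rule measure_mono_fmeasurable[OF _ _ U])
    show "(\<Union>i\<in>q. {Inf (snd i)<..<Sup (snd i)}) \<subseteq> U"
    proof
      fix z assume "z \<in> (\<Union>i\<in>q. {Inf (snd i)<..<Sup (snd i)})"
      then obtain i where i: "i \<in> q" "z \<in> {Inf (snd i)..Sup (snd i)}" by fastforce
      then show "z \<in> U" using iv[OF i(1)] sub[of "fst i" "snd i"] by auto
    qed
  qed (intro sets.finite_UN fin; simp)
  finally show "(\<Sum>i\<in>q. Sup (snd i) - Inf (snd i)) \<le> measure lebesgue U" .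
qed

text \<open>Over a tagged division fine enough for the gauge below, the intervals tagged in \<open>N\<close> lie in an
  open set of small measure and are controlled by absolute continuity; on the remaining ones the
  derivative controls the increment. No Vitali covering or Lebesgue integral is needed.\<close>

lemma absolutely_continuous_inner_ge:
  fixes x :: "real \<Rightarrow> 'a::euclidean_space"
  assumes ac: "absolutely_continuous_fun_on {a..b} x" and "a \<le> b" and N: "negligible N"
    and der: "\<And>t. t \<in> {a..b} - N \<Longrightarrow>
       \<exists>d. (x has_vector_derivative d) (at t within {a..b}) \<and> c \<le> d \<bullet> \<zeta>"
  shows "c * (b - a) \<le> (x b - x a) \<bullet> \<zeta>"
proof (rule field_le_epsilon)
  fix \<epsilon> :: real assume "\<epsilon> > 0"
  \<comment> \<open>\<open>e1\<close> is the error per unit length where the derivative is used.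
    \<open>e2\<close> bounds both the total increment and the total length of the intervals tagged
    in \<open>N\<close>. Each kind of error costs at most \<open>\<epsilon> / 2\<close>.\<close>
  define e1 where "e1 = \<epsilon> / (2 * (b - a + 1))"
  define e2 where "e2 = \<epsilon> / (2 * (norm \<zeta> + \<bar>c\<bar> + 1))"
  have "norm \<zeta> + \<bar>c\<bar> + 1 > 0" by (simp add: add_nonneg_pos)
  then have e1: "e1 > 0" and e2: "e2 > 0"
    unfolding e1_def e2_def using \<open>\<epsilon> > 0\<close> \<open>a \<le> b\<close> by auto
  obtain \<delta> where "\<delta> > 0" and \<delta>: "\<forall>(I :: (real \<times> real set) set) u v. finite I
        \<longrightarrow> (\<forall>i\<in>I. u i \<le> v i \<and> {u i..v i} \<subseteq> {a..b})
        \<longrightarrow> disjoint_family_on (\<lambda>i. {u i<..<v i}) I \<longrightarrow> (\<Sum>i\<in>I. v i - u i) < \<delta>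
        \<longrightarrow> (\<Sum>i\<in>I. norm (x (v i) - x (u i))) < e2"
    using absolutely_continuous_fun_on_finite[OF ac e2] by (elim exE conjE)
  have "N \<in> sets lebesgue" using N by (simp add: negligible_iff_null_sets null_setsD2)
  \<comment> \<open>The measure of \<open>U\<close> must be below \<open>\<delta>\<close> for
    absolute continuity to apply, and below \<open>e2\<close> so that the length lost inside
    \<open>U\<close> is cheap.\<close>
  moreover have "min \<delta> e2 > 0" using \<open>\<delta> > 0\<close> e2 by simp
  ultimately obtain U where U: "open U" "N \<subseteq> U" "U - N \<in> lmeasurable"
      "emeasure lebesgue (U - N) < ennreal (min \<delta> e2)"
    by (rule sets_lebesgue_outer_open)
  have UN: "U = (U - N) \<union> N" using U by blast
  have Um: "U \<in> lmeasurable" using U(3) N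
    by (metis UN fmeasurable.Un negligible_imp_measurable)
  have mU: "measure lebesgue U < min \<delta> e2"
  proof -
    have "measure lebesgue U = measure lebesgue (U - N)"
      using U(3) N by (metis measure_Diff_null_set Um negligible_iff_null_sets fmeasurableD)
    then show ?thesis using U(3,4) \<open>min \<delta> e2 > 0\<close>
      by (simp add: emeasure_eq_measure2 ennreal_less_iff)
  qed
  have "\<exists>r>0. \<forall>u v. t \<in> {u..v} \<and> {u..v} \<subseteq> ball t r \<inter> {a..b} \<longrightarrow>
      (if t \<in> N then {u..v} \<subseteq> U else (c - e1) * (v - u) \<le> (x v - x u) \<bullet> \<zeta>)" if t: "t \<in> {a..b}" for t
  proof (cases "t \<in> N")
    case True
    then obtain r where "r > 0" "ball t r \<subseteq> U" using U open_contains_ball by blast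
    then show ?thesis using True by (intro exI[of _ r]) auto
  next
    case False
    then obtain d where d: "(x has_vector_derivative d) (at t within {a..b})" "c \<le> d \<bullet> \<zeta>"
      using der t by blast
    have "((\<lambda>t. x t \<bullet> \<zeta>) has_vector_derivative d \<bullet> \<zeta>) (at t within {a..b})"
      using bounded_linear.has_vector_derivative[OF bounded_linear_inner_left d(1)] .
    then obtain r where r: "r > 0" "\<And>s. s \<in> {a..b} \<Longrightarrow> norm (s - t) < r \<Longrightarrow>
        norm (x s \<bullet> \<zeta> - x t \<bullet> \<zeta> - (s - t) *\<^sub>R (d \<bullet> \<zeta>)) \<le> e1 * norm (s - t)"
      unfolding has_vector_derivative_def has_derivative_within_alt using e1 by blast
    have "(c - e1) * (v - u) \<le> (x v - x u) \<bullet> \<zeta>"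
      if uv: "t \<in> {u..v}" "{u..v} \<subseteq> ball t r \<inter> {a..b}" for u v
    proof -
      have "u \<in> {u..v}" "v \<in> {u..v}" using uv by auto
      then have uv': "u \<in> ball t r" "v \<in> ball t r" "u \<in> {a..b}" "v \<in> {a..b}" using uv(2) by blast+
      then have "norm (x u \<bullet> \<zeta> - x t \<bullet> \<zeta> - (u - t) *\<^sub>R (d \<bullet> \<zeta>)) \<le> e1 * norm (u - t)"
        "norm (x v \<bullet> \<zeta> - x t \<bullet> \<zeta> - (v - t) *\<^sub>R (d \<bullet> \<zeta>)) \<le> e1 * norm (v - t)"
        using r(2)[of u] r(2)[of v] by (simp_all add: dist_norm norm_minus_commute)
      \<comment> \<open>Straddle estimate: the tag \<open>t\<close> lies between \<open>u\<close>
        and \<open>v\<close>, so the errors at the two ends add up to exactly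
        \<open>e1 * (v - u)\<close>.\<close>
      then have "x u \<bullet> \<zeta> - x t \<bullet> \<zeta> \<le> (u - t) * (d \<bullet> \<zeta>) + e1 * (t - u)"
        "x v \<bullet> \<zeta> - x t \<bullet> \<zeta> \<ge> (v - t) * (d \<bullet> \<zeta>) - e1 * (v - t)"
        using uv by (auto simp: abs_le_iff)
      moreover have "(v - u) * c \<le> (v - u) * (d \<bullet> \<zeta>)"
        using d(2) uv by (intro mult_left_mono) auto
      ultimately show ?thesis by (simp add: algebra_simps)
    qed
    then show ?thesis using False r(1) by auto
  qed
  then obtain r where r: "\<And>t. t \<in> {a..b} \<Longrightarrow> r t > 0"
    "\<And>t u v. t \<in> {a..b} \<Longrightarrow> t \<in> {u..v} \<Longrightarrow> {u..v} \<subseteq> ball t (r t) \<inter> {a..b} \<Longrightarrow>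
      (if t \<in> N then {u..v} \<subseteq> U else (c - e1) * (v - u) \<le> (x v - x u) \<bullet> \<zeta>)"
    by metis
  \<comment> \<open>The radius 1 outside \<open>{a..b}\<close> is a dummy value that makes
    \<open>g\<close> a gauge on the whole line.\<close>
  define g where "g t = ball t (if t \<in> {a..b} then r t else 1)" for t
  have "gauge g" unfolding gauge_def g_def using r(1) by auto
  then obtain p where p: "p tagged_division_of {a..b}" "g fine p"
    using fine_division_exists_real by blast
  have fin: "finite p" using p by auto
  have ptd: "p tagged_partial_division_of {a..b}" using p(1) by (simp add: tagged_division_of_def)
  have good: "if t \<in> N then k \<subseteq> U else (c - e1) * (Sup k - Inf k) \<le> (x (Sup k) - x (Inf k)) \<bullet> \<zeta>"
    and kiv: "Inf k \<le> Sup k" "{Inf k..Sup k} \<subseteq> {a..b}" if tk: "(t, k) \<in> p" for t k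
  proof -
    obtain u v where k: "k = {u..v}" "t \<in> k" "k \<subseteq> {a..b}"
      using tagged_division_ofD[OF p(1)] tk by (metis box_real(2))
    have "k \<subseteq> g t" using p(2) tk by (auto simp: fine_def)
    moreover have t: "t \<in> {a..b}" using k by blast
    ultimately have "{u..v} \<subseteq> ball t (r t) \<inter> {a..b}" using k by (auto simp: g_def)
    then show "if t \<in> N then k \<subseteq> U else (c - e1) * (Sup k - Inf k) \<le> (x (Sup k) - x (Inf k)) \<bullet> \<zeta>"
      using r(2)[OF t, of u v] k by auto
    show "Inf k \<le> Sup k" "{Inf k..Sup k} \<subseteq> {a..b}" using k by auto
  qed
  define q where "q = {i \<in> p. fst i \<in> N}"
  have qp: "q \<subseteq> p" by (auto simp: q_def)
  have qtd: "q tagged_partial_division_of {a..b}" using tagged_partial_division_subset[OF ptd qp] .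
  have qU: "k \<subseteq> U" if "(t, k) \<in> q" for t k
    using good[of t k] that by (auto simp: q_def)
  have q: "(\<Sum>i\<in>q. Sup (snd i) - Inf (snd i)) \<le> measure lebesgue U"
    "disjoint_family_on (\<lambda>i. {Inf (snd i)<..<Sup (snd i)}) q"
    using qU by (intro tagged_partial_division_length_le[OF qtd Um]; blast)+
  have finq: "finite q" using fin qp finite_subset by blast
  define len where "len i = Sup (snd i) - Inf (snd i)" for i :: "real \<times> real set"
  define \<Delta> where "\<Delta> i = x (Sup (snd i)) - x (Inf (snd i))" for i :: "real \<times> real set"
  have lenq: "sum len q < min \<delta> e2" using q(1) mU by (simp add: len_def)
  have "sum (\<lambda>i. norm (\<Delta> i)) q < e2"
    unfolding \<Delta>_def
  proof (rule \<delta>[rule_format, OF finq _ q(2)])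
    show "Inf (snd i) \<le> Sup (snd i) \<and> {Inf (snd i)..Sup (snd i)} \<subseteq> {a..b}" if "i \<in> q" for i
      using kiv[of "fst i" "snd i"] qp that by auto
  qed (use lenq in \<open>simp add: len_def\<close>)
  moreover have nonneg: "len i \<ge> 0" if "i \<in> p" for i
    using kiv[of "fst i" "snd i"] that by (auto simp: len_def)
  have lq0: "sum len q \<ge> 0" using nonneg qp by (intro sum_nonneg) auto
  have "(\<Sum>i\<in>q. \<Delta> i \<bullet> \<zeta>) \<ge> (\<Sum>i\<in>q. - norm \<zeta> * norm (\<Delta> i))"
  proof (rule sum_mono)
    fix i show "- norm \<zeta> * norm (\<Delta> i) \<le> \<Delta> i \<bullet> \<zeta>"
      using Cauchy_Schwarz_ineq2[of "\<Delta> i" \<zeta>] by (auto simp: mult.commute)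
  qed
  then have "(\<Sum>i\<in>q. \<Delta> i \<bullet> \<zeta>) \<ge> - norm \<zeta> * (\<Sum>i\<in>q. norm (\<Delta> i))"
    by (simp add: sum_distrib_left)
  ultimately have Dq: "(\<Sum>i\<in>q. \<Delta> i \<bullet> \<zeta>) \<ge> - norm \<zeta> * e2"
    by (smt (verit) mult_left_mono norm_ge_zero mult_minus_left)
  have cq: "c * sum len q \<le> \<bar>c\<bar> * e2"
    using lq0 lenq by (smt (verit) mult_mono abs_ge_zero mult_left_mono mult_right_mono)
  have "(\<Sum>i\<in>p - q. (c - e1) * len i) \<le> (\<Sum>i\<in>p - q. \<Delta> i \<bullet> \<zeta>)"
  proof (rule sum_mono)
    fix i assume "i \<in> p - q"
    then show "(c - e1) * len i \<le> \<Delta> i \<bullet> \<zeta>"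
      using good[of "fst i" "snd i"] by (auto simp: q_def len_def \<Delta>_def)
  qed
  then have Dp: "(c - e1) * sum len (p - q) \<le> (\<Sum>i\<in>p - q. \<Delta> i \<bullet> \<zeta>)"
    by (simp add: sum_distrib_left)
  have split: "sum h p = sum h (p - q) + sum h q" for h :: "_ \<Rightarrow> real"
    using sum.subset_diff[OF qp fin] .
  have lenp: "sum len p = b - a"
    using additive_tagged_division_1[OF \<open>a \<le> b\<close> p(1), of "\<lambda>t. t"] by (simp add: len_def case_prod_beta)
  have "sum \<Delta> p = x b - x a"
    using additive_tagged_division_1[OF \<open>a \<le> b\<close> p(1), of x] by (simp add: \<Delta>_def case_prod_beta)
  then have "(x b - x a) \<bullet> \<zeta> = (\<Sum>i\<in>p. \<Delta> i \<bullet> \<zeta>)" by (metis inner_sum_left)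
  then have "(x b - x a) \<bullet> \<zeta> \<ge> (c - e1) * sum len (p - q) - norm \<zeta> * e2"
    using Dp Dq split by (smt (verit) mult_minus_left)
  \<comment> \<open>The derivative bound only sees the length of \<open>p - q\<close>; the length of
    \<open>q\<close> still missing from \<open>b - a\<close> is paid for by
    \<open>cq\<close>.\<close>
  moreover have "(c - e1) * sum len (p - q) = c * (b - a) - c * sum len q - e1 * sum len (p - q)"
    using split[of len] lenp by (simp add: algebra_simps)
  moreover have "e1 * sum len (p - q) \<le> e1 * (b - a)"
    using split[of len] lenp lq0 e1 by (intro mult_left_mono) auto
  moreover have "e1 * (b - a) \<le> \<epsilon> / 2"
    unfolding e1_def using \<open>\<epsilon> > 0\<close> \<open>a \<le> b\<close> by (simp add: field_simps)
  moreover have "(norm \<zeta> + \<bar>c\<bar>) * e2 \<le> \<epsilon> / 2"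
    unfolding e2_def using \<open>\<epsilon> > 0\<close> \<open>norm \<zeta> + \<bar>c\<bar> + 1 > 0\<close> by (simp add: field_simps)
  ultimately show "c * (b - a) \<le> (x b - x a) \<bullet> \<zeta> + \<epsilon>"
    using cq by (simp add: algebra_simps)
qed

subsection \<open>Trajectories\<close>

text \<open>An explicit negligible set is easier to handle than the almost-everywhere quantifier: it
  can be translated, united with another one and enlarged by finitely many points.\<close>

lemma trajectory_iff:
  "trajectory F T y x \<longleftrightarrow> absolutely_continuous_fun_on {0..T} x \<and> x 0 = y \<and>
    (\<exists>N. negligible N \<and> (\<forall>t\<in>{0..T} - N. \<exists>v\<in>F (x t). (x has_vector_derivative v) (at t within {0..T})))"
proof -
  have "(AE t in lebesgue_on {0..T}. P t) \<longleftrightarrow> (\<exists>N. negligible N \<and> (\<forall>t\<in>{0..T} - N. P t))" for P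
  proof -
    have "(AE t in lebesgue_on {0..T}. P t) \<longleftrightarrow> (AE t in lebesgue. t \<in> {0..T} \<longrightarrow> P t)"
      by (rule AE_restrict_space_iff) simp
    also have "\<dots> \<longleftrightarrow> (\<exists>N\<in>null_sets lebesgue. {t. \<not> (t \<in> {0..T} \<longrightarrow> P t)} \<subseteq> N)"
      by (simp add: eventually_ae_filter)
    also have "\<dots> \<longleftrightarrow> (\<exists>N. N \<in> null_sets lebesgue \<and> (\<forall>t\<in>{0..T} - N. P t))"
      by blast
    finally show ?thesis unfolding negligible_iff_null_sets .
  qed
  then show ?thesis unfolding trajectory_def by (simp only: conj_ac)
qed

lemma trajectory_take:
  assumes "trajectory F T y x" "s \<le> T"
  shows "trajectory F s y x"
proof -
  obtain N where N: "negligible N"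
    "\<forall>t\<in>{0..T} - N. \<exists>v\<in>F (x t). (x has_vector_derivative v) (at t within {0..T})"
    using assms(1) unfolding trajectory_iff by (elim conjE exE)
  have "{0..s} \<subseteq> {0..T}" using assms(2) by auto
  then have "\<forall>t\<in>{0..s} - N. \<exists>v\<in>F (x t). (x has_vector_derivative v) (at t within {0..s})"
    using N(2) has_vector_derivative_within_subset by (metis Diff_iff subsetD)
  moreover have "absolutely_continuous_fun_on {0..s} x"
    using assms \<open>{0..s} \<subseteq> {0..T}\<close> absolutely_continuous_fun_on_subset unfolding trajectory_iff by blast
  ultimately show ?thesis using N(1) assms(1) unfolding trajectory_iff by blast
qed

lemma trajectory_drop:
  assumes "trajectory F T y x" "0 \<le> s" "s \<le> T"
  shows "trajectory F (T - s) (x s) (\<lambda>t. x (s + t))"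
proof -
  obtain N where N: "negligible N"
    "\<forall>t\<in>{0..T} - N. \<exists>v\<in>F (x t). (x has_vector_derivative v) (at t within {0..T})"
    using assms(1) unfolding trajectory_iff by (elim conjE exE)
  show ?thesis unfolding trajectory_iff
  proof (intro conjI exI ballI)
    show "absolutely_continuous_fun_on {0..T - s} (\<lambda>t. x (s + t))"
    proof (rule absolutely_continuous_fun_on_compose[where S="{0..T}"])
      show "absolutely_continuous_fun_on {0..T} x" using assms(1) by (simp add: trajectory_iff)
    qed (use assms in \<open>auto simp: mono_def\<close>)
    show "negligible ((+) (- s) ` N)" by (rule negligible_translation[OF N(1)])
    fix t assume t: "t \<in> {0..T - s} - (+) (- s) ` N"
    have "s + t \<notin> N"
    proof
      assume "s + t \<in> N"
      then have "- s + (s + t) \<in> (+) (- s) ` N" by blast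
      then show False using t by simp
    qed
    then obtain v where v: "v \<in> F (x (s + t))" "(x has_vector_derivative v) (at (s + t) within {0..T})"
      using N(2) t assms by force
    have "(\<lambda>t. s + t) ` {0..T - s} \<subseteq> {0..T}" using assms by auto
    then have "(x has_vector_derivative v) (at (s + t) within (\<lambda>t. s + t) ` {0..T - s})"
      using v(2) has_vector_derivative_within_subset by blast
    moreover have "((\<lambda>t. s + t) has_vector_derivative 1) (at t within {0..T - s})"
      by (auto intro!: derivative_eq_intros simp: has_vector_derivative_def)
    ultimately have "((\<lambda>t. x (s + t)) has_vector_derivative v) (at t within {0..T - s})"
      using vector_diff_chain_within[of "\<lambda>t. s + t" 1 t "{0..T - s}" x v] by (simp add: o_def)
    then show "\<exists>v\<in>F (x (s + t)). ((\<lambda>t. x (s + t)) has_vector_derivative v) (at t within {0..T - s})"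
      using v(1) by blast
  qed simp
qed

lemma trajectory_append:
  assumes w: "trajectory F s y w" and x: "trajectory F T (w s) x" and "0 \<le> s" "0 \<le> T"
  shows "trajectory F (s + T) y (\<lambda>t. if t \<le> s then w t else x (t - s))"
proof -
  let ?z = "\<lambda>t. if t \<le> s then w t else x (t - s)"
  obtain N1 where N1: "negligible N1"
    "\<forall>t\<in>{0..s} - N1. \<exists>v\<in>F (w t). (w has_vector_derivative v) (at t within {0..s})"
    using w unfolding trajectory_iff by (elim conjE exE)
  obtain N2 where N2: "negligible N2"
    "\<forall>t\<in>{0..T} - N2. \<exists>v\<in>F (x t). (x has_vector_derivative v) (at t within {0..T})"
    using x unfolding trajectory_iff by (elim conjE exE)
  have x0: "x 0 = w s" using x by (simp add: trajectory_iff)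
  \<comment> \<open>The concatenation is the sum of both pieces, each frozen outside its own time
    interval, minus the common value at the junction. This reduces its absolute continuity to sums
    and compositions.\<close>
  have "absolutely_continuous_fun_on {0..s + T} (\<lambda>t. w (min t s))"
  proof (rule absolutely_continuous_fun_on_compose[where S="{0..s}"])
    show "absolutely_continuous_fun_on {0..s} w" using w by (simp add: trajectory_iff)
  qed (use \<open>0 \<le> s\<close> \<open>0 \<le> T\<close> in \<open>auto simp: mono_def min_def\<close>)
  moreover have "absolutely_continuous_fun_on {0..s + T} (\<lambda>t. x (max (t - s) 0))"
  proof (rule absolutely_continuous_fun_on_compose[where S="{0..T}"])
    show "absolutely_continuous_fun_on {0..T} x" using x by (simp add: trajectory_iff)
  qed (use \<open>0 \<le> s\<close> \<open>0 \<le> T\<close> in \<open>auto simp: mono_def max_def\<close>)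
  moreover have "absolutely_continuous_fun_on {0..s + T} (\<lambda>t. - w s)"
    using lipschitz_on_imp_absolutely_continuous_fun_on[of 0 "{0..s + T}" "\<lambda>t. - w s"]
    by (simp add: lipschitz_on_def)
  ultimately have "absolutely_continuous_fun_on {0..s + T} (\<lambda>t. w (min t s) + (x (max (t - s) 0) + - w s))"
    by (intro absolutely_continuous_fun_on_add)
  moreover have "(\<lambda>t. w (min t s) + (x (max (t - s) 0) + - w s)) = ?z"
    using x0 by (auto simp: fun_eq_iff min_def max_def)
  ultimately have ac: "absolutely_continuous_fun_on {0..s + T} ?z" by simp
  show ?thesis unfolding trajectory_iff
  proof (intro conjI exI ballI)
    show "absolutely_continuous_fun_on {0..s + T} ?z" by (rule ac)
    show "?z 0 = y" using w \<open>0 \<le> s\<close> by (simp add: trajectory_iff)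
    \<comment> \<open>Discarding the end points and the junction leaves times in the interior of one
      piece, where the one-piece derivative is two-sided and passes to the concatenation.\<close>
    show "negligible (N1 \<union> (+) s ` N2 \<union> {0, s, s + T})"
      by (intro negligible_Un N1(1) negligible_translation[OF N2(1)] negligible_finite) simp
    fix t assume t: "t \<in> {0..s + T} - (N1 \<union> (+) s ` N2 \<union> {0, s, s + T})"
    then have t': "0 < t" "t < s + T" "t \<noteq> s" "t \<notin> N1" by auto
    have "\<exists>v\<in>F (?z t). (?z has_vector_derivative v) (at t)"
    proof (cases "t < s")
      case True
      then obtain v where v: "v \<in> F (w t)" "(w has_vector_derivative v) (at t within {0..s})"
        using N1(2) t' by force
      then have "(w has_vector_derivative v) (at t)" using True t' by (simp add: at_within_Icc_at)
      then have "(?z has_vector_derivative v) (at t)"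
        by (rule has_vector_derivative_transform_within_open[where S="{..<s}"]) (use True in auto)
      then show ?thesis using v(1) True by auto
    next
      case False
      have "t - s \<notin> N2"
      proof
        assume "t - s \<in> N2"
        then have "s + (t - s) \<in> (+) s ` N2" by blast
        then show False using t by simp
      qed
      then obtain v where v: "v \<in> F (x (t - s))" "(x has_vector_derivative v) (at (t - s) within {0..T})"
        using N2(2) t' False by force
      then have "(x has_vector_derivative v) (at (t - s))" using False t' by (simp add: at_within_Icc_at)
      moreover have "((\<lambda>t. t - s) has_vector_derivative 1) (at t)"
        by (auto intro!: derivative_eq_intros simp: has_vector_derivative_def)
      ultimately have "((\<lambda>t. x (t - s)) has_vector_derivative v) (at t)"
        using vector_diff_chain_at[of "\<lambda>t. t - s" 1 t x v] by (simp add: o_def)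
      then have "(?z has_vector_derivative v) (at t)"
        by (rule has_vector_derivative_transform_within_open[where S="{s<..}"]) (use False t' in auto)
      then show ?thesis using v(1) False t'(3) by auto
    qed
    then obtain v where "v \<in> F (?z t)" "(?z has_vector_derivative v) (at t within {0..s + T})"
      by (elim bexE, intro that) (assumption, erule has_vector_derivative_at_within)
    then show "\<exists>v\<in>F (?z t). (?z has_vector_derivative v) (at t within {0..s + T})"
      by (intro bexI)
  qed
qed

text \<open>By the mean value inequality a bounded velocity makes \<open>x\<close> Lipschitz, hence
  absolutely continuous; the exceptional set is empty.\<close>

lemma trajectory_C1I:
  assumes der: "\<And>t. t \<in> {0..T} \<Longrightarrow> (x has_vector_derivative w t) (at t within {0..T})"
    and F: "\<And>t. t \<in> {0..T} \<Longrightarrow> w t \<in> F (x t)"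
    and M: "0 \<le> M" "\<And>t. t \<in> {0..T} \<Longrightarrow> norm (w t) \<le> M"
  shows "trajectory F T (x 0) x"
proof -
  have "M-lipschitz_on {0..T} x"
  proof (rule lipschitz_onI[OF _ M(1)])
    fix s t assume st: "s \<in> {0..T}" "t \<in> {0..T}"
    have "norm (x s - x t) \<le> M * norm (s - t)"
    proof (rule differentiable_bound[where S="{0..T}" and f'="\<lambda>t h. h *\<^sub>R w t"])
      show "onorm (\<lambda>h. h *\<^sub>R w t) \<le> M" if "t \<in> {0..T}" for t
        using mult_left_mono[OF M(2)[OF that] abs_ge_zero] by (intro onorm_le) (simp add: mult.commute)
    qed (use der st in \<open>auto simp: has_vector_derivative_def\<close>)
    then show "dist (x s) (x t) \<le> M * dist s t" by (simp add: dist_norm)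
  qed
  then have "absolutely_continuous_fun_on {0..T} x"
    by (rule lipschitz_on_imp_absolutely_continuous_fun_on)
  moreover have "\<forall>t\<in>{0..T} - {}. \<exists>v\<in>F (x t). (x has_vector_derivative v) (at t within {0..T})"
    using der F by blast
  ultimately show ?thesis unfolding trajectory_iff using negligible_empty by blast
qed

section \<open>Growth estimates along trajectories\<close>

lemma trajectory_continuous_on: "trajectory F T y x \<Longrightarrow> continuous_on {0..T} x"
  unfolding trajectory_iff by (blast intro: absolutely_continuous_fun_on_imp_continuous_on)

text \<open>Integrates a bound on all admissible velocities. The bound is asked for only when
  \<open>t < T\<close>, which allows \<open>T\<close> to be a first exit time; the final instant
  joins the negligible set.\<close>

lemma trajectory_inner_ge:
  assumes x: "trajectory F T y x" and "0 \<le> T"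
    and c: "\<And>t v. 0 \<le> t \<Longrightarrow> t < T \<Longrightarrow> v \<in> F (x t) \<Longrightarrow> c \<le> v \<bullet> \<zeta>"
  shows "c * T \<le> (x T - y) \<bullet> \<zeta>"
proof -
  obtain N where N: "negligible N"
    "\<forall>t\<in>{0..T} - N. \<exists>v\<in>F (x t). (x has_vector_derivative v) (at t within {0..T})"
    using x unfolding trajectory_iff by (elim conjE exE)
  have "c * (T - 0) \<le> (x T - x 0) \<bullet> \<zeta>"
  proof (rule absolutely_continuous_inner_ge[where N="N \<union> {T}"])
    show "absolutely_continuous_fun_on {0..T} x" using x by (simp add: trajectory_iff)
    show "negligible (N \<union> {T})" using N(1) by (intro negligible_Un) auto
    fix t assume "t \<in> {0..T} - (N \<union> {T})"
    then show "\<exists>d. (x has_vector_derivative d) (at t within {0..T}) \<and> c \<le> d \<bullet> \<zeta>"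
      using N(2) c[of t] by (metis Diff_iff UnCI atLeastAtMost_iff insertI1 order_le_less)
  qed (use \<open>0 \<le> T\<close> in auto)
  then show ?thesis using x by (simp add: trajectory_iff)
qed

text \<open>Testing the displacement \<open>z\<close> against itself reduces the vector estimate to
  the scalar one: the square of \<open>norm z\<close> is at most
  \<open>norm z * (M * T)\<close>.\<close>

lemma trajectory_norm_le:
  assumes x: "trajectory F T y x" and "0 \<le> T"
    and M: "\<And>t v. 0 \<le> t \<Longrightarrow> t < T \<Longrightarrow> v \<in> F (x t) \<Longrightarrow> norm v \<le> M"
  shows "norm (x T - y) \<le> M * T"
proof -
  define z where "z = x T - y"
  have "(- (M * norm z)) * T \<le> (x T - y) \<bullet> (- z)"
  proof (rule trajectory_inner_ge[OF x \<open>0 \<le> T\<close>])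
    fix t v assume "0 \<le> t" "t < T" "v \<in> F (x t)"
    then have "v \<bullet> z \<le> M * norm z"
      using M[of t v] norm_cauchy_schwarz[of v z] by (meson mult_right_mono norm_ge_zero order_trans)
    then show "- (M * norm z) \<le> v \<bullet> - z" by simp
  qed
  also have "\<dots> = - (norm z * norm z)"
    by (simp only: z_def[symmetric] inner_minus_right dot_square_norm power2_eq_square)
  finally have "norm z * norm z \<le> norm z * (M * T)" by (simp add: mult_ac)
  then show ?thesis
  proof (cases "norm z = 0")
    case True
    \<comment> \<open>When \<open>z = 0\<close> nothing can be cancelled and the sign of
      \<open>M\<close> has to be found: if \<open>T > 0\<close>, some time outside \<open>N\<close>
      carries a velocity, and its norm is at most \<open>M\<close>.\<close>
    have "0 \<le> M * T"
    proof (cases "T = 0")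
      case False
      then have "T > 0" using \<open>0 \<le> T\<close> by simp
      obtain N where N: "negligible N"
        "\<forall>t\<in>{0..T} - N. \<exists>v\<in>F (x t). (x has_vector_derivative v) (at t within {0..T})"
        using x unfolding trajectory_iff by (elim conjE exE)
      have "\<not> {0<..<T} \<subseteq> N"
        using N(1) negligible_subset open_not_negligible[of "{0<..<T}"] \<open>T > 0\<close> by auto
      then obtain t v where "0 < t" "t < T" "v \<in> F (x t)" using N(2) by force
      then have "0 \<le> M" using M[of t v] norm_ge_zero[of v] by linarith
      then show ?thesis using \<open>T > 0\<close> by simp
    qed simp
    then show ?thesis using True by (simp add: z_def)
  qed (use \<open>norm z * norm z \<le> norm z * (M * T)\<close> in \<open>simp add: z_def\<close>)
qed

text \<open>First exit argument. Up to the first time \<open>s\<close> at distance at least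
  \<open>\<rho>\<close> from \<open>y\<close> the speed is at most \<open>M\<close>, so the distance
  at \<open>s\<close> is at most \<open>M * T < \<rho>\<close>, a contradiction. Hence the local
  speed bound holds on the whole interval.\<close>

lemma trajectory_local_speed:
  assumes x: "trajectory F T y x" and "0 \<le> T" and T: "M * T < \<rho>" and "0 \<le> M"
    and M: "\<And>z v. norm (z - y) < \<rho> \<Longrightarrow> v \<in> F z \<Longrightarrow> norm v \<le> M"
    and t: "t \<in> {0..T}"
  shows "norm (x t - y) \<le> M * t"
proof -
  define C where "C = {t \<in> {0..T}. \<rho> \<le> norm (x t - y)}"
  have "C = {}"
  proof (rule ccontr)
    assume "C \<noteq> {}"
    have "continuous_on {0..T} (\<lambda>t. norm (x t - y))"
      using trajectory_continuous_on[OF x] by (intro continuous_intros)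
    moreover have "C = {0..T} \<inter> (\<lambda>t. norm (x t - y)) -` {\<rho>..}" by (auto simp: C_def)
    ultimately have "closed C" using continuous_closed_preimage by (metis closed_atLeast closed_atLeastAtMost)
    moreover have "bounded C" unfolding C_def by (rule bounded_subset[of "{0..T}"]) auto
    ultimately have "compact C" by (simp add: compact_eq_bounded_closed)
    then obtain s where s: "s \<in> C" "\<And>t. t \<in> C \<Longrightarrow> s \<le> t"
      using compact_attains_inf[OF _ \<open>C \<noteq> {}\<close>] by blast
    have sT: "0 \<le> s" "s \<le> T" using s(1) by (auto simp: C_def)
    have "norm (x s - y) \<le> M * s"
    proof (rule trajectory_norm_le[OF trajectory_take[OF x sT(2)] sT(1)])
      fix t v assume t: "0 \<le> t" "t < s" "v \<in> F (x t)"
      then have "norm (x t - y) < \<rho>" using s(2)[of t] sT by (force simp: C_def)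
      then show "norm v \<le> M" using M t by blast
    qed
    also have "\<dots> \<le> M * T" using sT \<open>0 \<le> M\<close> by (intro mult_left_mono)
    finally show False using T s(1) by (auto simp: C_def)
  qed
  then have in_ball: "norm (x t - y) < \<rho>" if "t \<in> {0..T}" for t
    using that by (force simp: C_def)
  show ?thesis
  proof (rule trajectory_norm_le[OF trajectory_take[OF x]])
    fix u v assume "0 \<le> u" "u < t" "v \<in> F (x u)"
    then show "norm v \<le> M" using in_ball[of u] t M by auto
  qed (use t in auto)
qed

subsection \<open>Differential inclusions with Lipschitz right-hand side\<close>

lemma F2D:
  assumes "F2 F" "compact Q"
  obtains L where "L > 0"
    "\<And>x y v. x \<in> Q \<Longrightarrow> y \<in> Q \<Longrightarrow> v \<in> F x \<Longrightarrow> \<exists>u\<in>F y. norm (u - v) \<le> L * norm (y - x)"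
proof -
  obtain L where L: "L > 0"
    "\<forall>x\<in>Q. \<forall>y\<in>Q. F x \<subseteq> {v + (L * norm (y - x)) *\<^sub>R b | v b. v \<in> F y \<and> b \<in> cball 0 1}"
    using assms unfolding F2_def by blast
  show ?thesis
  proof (rule that[OF L(1)])
    fix x y v assume xyv: "x \<in> Q" "y \<in> Q" "v \<in> F x"
    then have "v \<in> {v + (L * norm (y - x)) *\<^sub>R b | v b. v \<in> F y \<and> b \<in> cball 0 1}" using L(2) by blast
    then obtain u b where ub: "u \<in> F y" "norm b \<le> 1" "v = u + (L * norm (y - x)) *\<^sub>R b" by auto
    then have "norm (u - v) = L * norm (y - x) * norm b" using L(1) by simp
    also have "\<dots> \<le> L * norm (y - x)" using ub(2) L(1) by (simp add: mult_left_le)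
    finally show "\<exists>u\<in>F y. norm (u - v) \<le> L * norm (y - x)" using ub(1) by blast
  qed
qed

text \<open>Here \<open>\<eta>\<close> bounds the Hausdorff distance. The variational inequality of
  each projection is tested at a point of its own set within \<open>\<eta>\<close> of the other
  projection, and the two are added. The resulting distance grows like the square root of
  \<open>\<eta>\<close>, which is enough for continuity.\<close>

lemma closest_point_hausdorff_le:
  fixes C D :: "'a::euclidean_space set"
  assumes C: "convex C" "closed C" "C \<noteq> {}" and D: "convex D" "closed D" "D \<noteq> {}"
    and CD: "\<And>c. c \<in> C \<Longrightarrow> \<exists>d\<in>D. norm (d - c) \<le> \<eta>"
    and DC: "\<And>d. d \<in> D \<Longrightarrow> \<exists>c\<in>C. norm (c - d) \<le> \<eta>"
  shows "(norm (closest_point C w - closest_point D w))\<^sup>2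
          \<le> \<eta> * (2 * norm (w - closest_point C w) + \<eta>)"
proof -
  define p where "p = closest_point C w"
  define q where "q = closest_point D w"
  have pC: "p \<in> C" unfolding p_def by (rule closest_point_in_set) (use C in auto)
  have qD: "q \<in> D" unfolding q_def by (rule closest_point_in_set) (use D in auto)
  obtain c where c: "c \<in> C" "norm (c - q) \<le> \<eta>" using DC qD by blast
  obtain d where d: "d \<in> D" "norm (d - p) \<le> \<eta>" using CD pC by blast
  have \<eta>: "\<eta> \<ge> 0" using c(2) norm_ge_zero order_trans by blast
  have qw: "norm (w - q) \<le> norm (w - p) + \<eta>"
  proof -
    have "norm (w - q) \<le> norm (w - d)"
      using closest_point_le[OF D(2) d(1), of w] by (simp add: q_def dist_norm)
    also have "\<dots> \<le> norm (w - p) + norm (d - p)"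
      by (metis norm_triangle_ineq4 diff_diff_eq2 add.commute diff_add_cancel)
    finally show ?thesis using d(2) by simp
  qed
  have "(w - p) \<bullet> (c - p) \<le> 0" using closest_point_dot[OF C(1,2) c(1)] by (simp add: p_def)
  moreover have "(w - p) \<bullet> (q - c) \<le> norm (w - p) * \<eta>"
    using norm_cauchy_schwarz[of "w - p" "q - c"] c(2)
    by (metis mult_left_mono norm_ge_zero norm_minus_commute order_trans)
  ultimately have 1: "(w - p) \<bullet> (q - p) \<le> norm (w - p) * \<eta>"
    by (simp add: inner_diff_right)
  have "(w - q) \<bullet> (d - q) \<le> 0" using closest_point_dot[OF D(1,2) d(1)] by (simp add: q_def)
  moreover have "(w - q) \<bullet> (p - d) \<le> norm (w - q) * \<eta>"
    using norm_cauchy_schwarz[of "w - q" "p - d"] d(2)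
    by (metis mult_left_mono norm_ge_zero norm_minus_commute order_trans)
  ultimately have 2: "(w - q) \<bullet> (p - q) \<le> norm (w - q) * \<eta>"
    by (simp add: inner_diff_right)
  have "(norm (p - q))\<^sup>2 = (w - p) \<bullet> (q - p) + (w - q) \<bullet> (p - q)"
    by (simp add: power2_norm_eq_inner algebra_simps inner_commute)
  also have "\<dots> \<le> norm (w - p) * \<eta> + norm (w - q) * \<eta>" using 1 2 by simp
  also have "\<dots> \<le> norm (w - p) * \<eta> + (norm (w - p) + \<eta>) * \<eta>"
    using qw \<eta> by (intro add_left_mono mult_right_mono)
  finally show ?thesis by (simp add: p_def q_def algebra_simps)
qed

text \<open>A global form of (F1) and (F2), with one Lipschitz constant on the whole space. It is
  applied to the time-reversed field, extended from a ball by projection.\<close>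

locale lipschitz_multifunction =
  fixes G :: "'a::euclidean_space \<Rightarrow> 'a set" and L :: real
  assumes convex_values: "convex (G x)"
    and closed_values: "closed (G x)"
    and nonempty_values: "G x \<noteq> {}"
    and L_nonneg: "0 \<le> L"
    and lipschitz_values: "v \<in> G x \<Longrightarrow> \<exists>u\<in>G y. norm (u - v) \<le> L * norm (y - x)"
begin

lemma closest_point_in_values: "closest_point (G x) w \<in> G x"
  by (rule closest_point_in_set) (use closed_values nonempty_values in auto)

text \<open>A point that already lies in one value has a point of the other value nearby, and the
  projection is no farther. This bound is linear, unlike \<open>closest_point_hausdorff_le\<close>,
  and makes the iteration contract.\<close>

lemma norm_closest_point_values_le:
  assumes "v \<in> G x"
  shows "norm (closest_point (G y) v - v) \<le> L * norm (y - x)"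
proof -
  obtain u where "u \<in> G y" "norm (u - v) \<le> L * norm (y - x)" using lipschitz_values[OF assms] by blast
  then show ?thesis using closest_point_le[OF closed_values, of u y v]
    by (simp add: dist_norm norm_minus_commute)
qed

text \<open>The change of the projection is split in two: moving the point costs no more than its
  displacement, since projections are nonexpansive, and moving the set is controlled by the
  Hausdorff estimate.\<close>

lemma continuous_on_closest_point_values:
  fixes x w :: "'b::topological_space \<Rightarrow> 'a"
  assumes "continuous_on S x" "continuous_on S w"
  shows "continuous_on S (\<lambda>t. closest_point (G (x t)) (w t))"
  unfolding continuous_on_def
proof
  fix t assume t: "t \<in> S"
  let ?p = "\<lambda>s. closest_point (G (x s)) (w s)"
  let ?n = "\<lambda>s. L * norm (x s - x t)"
  have x: "(x \<longlongrightarrow> x t) (at t within S)" and w: "(w \<longlongrightarrow> w t) (at t within S)"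
    using assms t by (auto simp: continuous_on_def)
  have le: "norm (?p s - ?p t) \<le> norm (w s - w t) + sqrt (?n s * (2 * norm (w t - ?p t) + ?n s))" for s
  proof -
    have "norm (?p s - closest_point (G (x s)) (w t)) \<le> norm (w s - w t)"
      using closest_point_lipschitz[OF convex_values closed_values nonempty_values, of "x s" "w s" "w t"]
      by (simp add: dist_norm)
    moreover have "norm (?p t - closest_point (G (x s)) (w t))
        \<le> sqrt (?n s * (2 * norm (w t - ?p t) + ?n s))"
      using lipschitz_values[of _ "x t" "x s"] lipschitz_values[of _ "x s" "x t"]
      by (intro real_le_rsqrt closest_point_hausdorff_le convex_values closed_values nonempty_values)
        (auto simp: norm_minus_commute)
    ultimately show ?thesis
      using norm_triangle_ineq4[of "?p s - closest_point (G (x s)) (w t)" "?p t - closest_point (G (x s)) (w t)"]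
      by (simp add: norm_minus_commute)
  qed
  have "((\<lambda>s. norm (w s - w t) + sqrt (?n s * (2 * norm (w t - ?p t) + ?n s))) \<longlongrightarrow>
      norm (w t - w t) + sqrt (?n t * (2 * norm (w t - ?p t) + ?n t))) (at t within S)"
    by (intro tendsto_intros x w)
  then have "((\<lambda>s. ?p s - ?p t) \<longlongrightarrow> 0) (at t within S)"
    by (intro Lim_null_comparison[OF always_eventually[OF allI[OF le]]]) simp
  then show "(?p \<longlongrightarrow> ?p t) (at t within S)" by (rule LIM_zero_cancel)
qed

text \<open>Iterating on velocities by metric projection keeps every iterate continuous, so that Filippov's
  successive approximations need no measurable selections here.\<close>

primrec filippov_iter :: "'a \<Rightarrow> 'a \<Rightarrow> nat \<Rightarrow> real \<Rightarrow> 'a" where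
  "filippov_iter x0 v0 0 = (\<lambda>t. v0)"
| "filippov_iter x0 v0 (Suc k) =
    (\<lambda>t. closest_point (G (x0 + integral {0..t} (filippov_iter x0 v0 k))) (filippov_iter x0 v0 k t))"

lemma continuous_on_filippov_iter: "continuous_on {0..T} (filippov_iter x0 v0 k)"
proof (induction k)
  case (Suc k)
  then show ?case unfolding filippov_iter.simps
    by (intro continuous_on_closest_point_values continuous_intros indefinite_integral_continuous_1
        integrable_continuous_real)
qed simp

text \<open>The iterate \<open>Suc k\<close> lies in the value at the position produced by iterate
  \<open>k\<close>. Projecting it onto the value at its own position therefore moves it by at most
  \<open>L\<close> times the change of position, which is at most \<open>t\<close> times the
  previous bound. As \<open>L * t \<le> 1/2\<close>, the bound halves.\<close>

lemma norm_filippov_iter_step_le: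
  assumes v0: "v0 \<in> G x0" and T: "L * T \<le> 1/2" and "t \<in> {0..T}"
  shows "norm (filippov_iter x0 v0 (Suc k) t - filippov_iter x0 v0 k t) \<le> L * T * norm v0 * (1/2)^k"
  using \<open>t \<in> {0..T}\<close>
proof (induction k arbitrary: t)
  case 0
  then have "norm (closest_point (G (x0 + t *\<^sub>R v0)) v0 - v0) \<le> L * norm (x0 + t *\<^sub>R v0 - x0)"
    using norm_closest_point_values_le[OF v0] by blast
  also have "\<dots> = L * t * norm v0" using 0 by simp
  also have "\<dots> \<le> L * T * norm v0" using 0 L_nonneg by (intro mult_right_mono mult_left_mono) auto
  finally show ?case using 0 by simp
next
  case (Suc k)
  define w where "w = filippov_iter x0 v0"
  define c where "c = L * T * norm v0 * (1/2)^k"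
  have "0 \<le> T" using Suc.prems by auto
  then have c: "c \<ge> 0" using L_nonneg by (simp add: c_def)
  have cont: "continuous_on {0..t} (w k)" for k
    unfolding w_def by (rule continuous_on_filippov_iter)
  then have int: "w k integrable_on {0..t}" for k by (rule integrable_continuous_real)
  have "w (Suc k) t \<in> G (x0 + integral {0..t} (w k))" by (simp add: w_def closest_point_in_values)
  then have "norm (w (Suc (Suc k)) t - w (Suc k) t)
      \<le> L * norm ((x0 + integral {0..t} (w (Suc k))) - (x0 + integral {0..t} (w k)))"
    unfolding w_def filippov_iter.simps(2)[of _ _ "Suc k"] by (rule norm_closest_point_values_le)
  also have "\<dots> = L * norm (integral {0..t} (\<lambda>s. w (Suc k) s - w k s))"
    using int by (simp add: integral_diff del: filippov_iter.simps)
  also have "\<dots> \<le> L * (c * (t - 0))"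
  proof (intro mult_left_mono integral_bound)
    show "continuous_on {0..t} (\<lambda>s. w (Suc k) s - w k s)" by (intro continuous_intros cont)
    show "norm (w (Suc k) s - w k s) \<le> c" if "s \<in> {0..t}" for s
      using Suc.IH[of s] that Suc.prems by (simp add: w_def c_def del: filippov_iter.simps)
  qed (use Suc.prems L_nonneg in auto)
  also have "\<dots> = (L * t) * c" by simp
  also have "\<dots> \<le> 1/2 * c"
  proof (intro mult_right_mono c)
    have "L * t \<le> L * T" using Suc.prems L_nonneg by (intro mult_left_mono) auto
    then show "L * t \<le> 1/2" using T by simp
  qed
  finally show ?case by (simp add: w_def c_def del: filippov_iter.simps)
qed

text \<open>The steps are summable uniformly in \<open>t\<close>, so the velocities converge
  uniformly to a continuous \<open>w\<close>, and the positions converge with them by integration.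
  Closed values and the Lipschitz condition preserve the inclusion in the limit.\<close>

theorem ex_C1_solution:
  assumes v0: "v0 \<in> G x0" and T: "L * T \<le> 1/2" "0 \<le> T"
  obtains w where "continuous_on {0..T} w" "w 0 = v0"
    "\<And>t. t \<in> {0..T} \<Longrightarrow> w t \<in> G (x0 + integral {0..t} w)"
proof -
  define W where "W = filippov_iter x0 v0"
  have step: "norm (W (Suc k) t - W k t) \<le> L * T * norm v0 * (1/2)^k" if "t \<in> {0..T}" for k t
    unfolding W_def by (rule norm_filippov_iter_step_le[OF v0 T(1) that])
  have "summable (\<lambda>k. L * T * norm v0 * (1/2::real)^k)" by (intro summable_mult summable_geometric) simp
  then have "uniform_limit {0..T} (\<lambda>n t. \<Sum>k<n. W (Suc k) t - W k t)
      (\<lambda>t. \<Sum>k. W (Suc k) t - W k t) sequentially"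
    by (intro Weierstrass_m_test[where M="\<lambda>k. L * T * norm v0 * (1/2)^k"]) (use step in auto)
  moreover have "(\<Sum>k<n. W (Suc k) t - W k t) = W n t - v0" for n t
    using sum_lessThan_telescope[of "\<lambda>k. W k t" n] by (simp add: W_def del: filippov_iter.simps(2))
  ultimately have "uniform_limit {0..T} (\<lambda>n t. W n t - v0) (\<lambda>t. \<Sum>k. W (Suc k) t - W k t) sequentially"
    by simp
  from uniform_limit_add[OF this uniform_limit_const[where c="\<lambda>_. v0"]]
  obtain w where lim: "uniform_limit {0..T} W w sequentially" by auto
  have contW: "continuous_on {0..t} (W k)" for t k unfolding W_def by (rule continuous_on_filippov_iter)
  show ?thesis
  proof
    show "continuous_on {0..T} w"
      using uniform_limit_theorem[OF _ lim] contW by simp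
    \<comment> \<open>At time 0 the position is always \<open>x0\<close>, and \<open>v0\<close>,
      being in \<open>G x0\<close>, is its own projection.\<close>
    have W0: "W k 0 = v0" for k
      unfolding W_def using v0 by (induction k) (auto simp: closest_point_self)
    have lim_pt: "(\<lambda>k. W k t) \<longlonglongrightarrow> w t" if "t \<in> {0..T}" for t
      using tendsto_uniform_limitI[OF lim that] .
    from lim_pt[of 0] T W0 show "w 0 = v0" by (simp add: LIMSEQ_const_iff)
    fix t assume t: "t \<in> {0..T}"
    define X where "X k = x0 + integral {0..t} (W k)" for k
    define x where "x = x0 + integral {0..t} w"
    have "uniform_limit {0..t} W w sequentially" using lim t by (auto intro: uniform_limit_on_subset)
    then obtain I J where IJ: "\<And>k. (W k has_integral I k) {0..t}" "(w has_integral J) {0..t}" "I \<longlonglongrightarrow> J"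
      by (rule uniform_limit_integral[OF _ contW]) auto
    have "X = (\<lambda>k. x0 + I k)" "x = x0 + J"
      using IJ(1,2) by (auto simp: X_def x_def integral_unique)
    then have X: "X \<longlonglongrightarrow> x" using IJ(3) by (auto intro: tendsto_intros)
    \<comment> \<open>\<open>W (Suc k) t\<close> belongs to the value at \<open>X k\<close>, not at
      the limit \<open>x\<close>; it is replaced by a nearby point of the fixed closed set
      \<open>G x\<close>.\<close>
    have "\<exists>u\<in>G x. norm (u - W (Suc k) t) \<le> L * norm (x - X k)" for k
      using lipschitz_values[of "W (Suc k) t" "X k" x] by (simp add: W_def X_def closest_point_in_values)
    then obtain u where u: "\<And>k. u k \<in> G x" "\<And>k. norm (u k - W (Suc k) t) \<le> L * norm (x - X k)" by metis
    have "(\<lambda>k. L * norm (x - X k)) \<longlonglongrightarrow> L * norm (x - x)" by (intro tendsto_intros X)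
    then have "(\<lambda>k. u k - W (Suc k) t) \<longlonglongrightarrow> 0"
      by (intro Lim_null_comparison[OF always_eventually[OF allI[OF u(2)]]]) simp
    from tendsto_add[OF this LIMSEQ_Suc[OF lim_pt[OF t]]] have "u \<longlonglongrightarrow> w t" by simp
    then show "w t \<in> G (x0 + integral {0..t} w)"
      using closed_sequentially[OF closed_values, of u x] u(1) by (simp add: x_def)
  qed
qed

end

text \<open>Solves the reversed inclusion from \<open>x0\<close> with initial velocity
  \<open>- v\<close>. Read backwards in time, the solution yields trajectories of \<open>F\<close>
  that end at \<open>x0\<close> with terminal velocity \<open>v\<close>.\<close>

lemma ex_C1_backward_trajectory:
  fixes F :: "'a::euclidean_space \<Rightarrow> 'a set"
  assumes F: "assumption_F F" and v: "v \<in> F x0"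
  obtains \<tau> x where "\<tau> > 0" "x 0 = x0" "(x has_vector_derivative - v) (at 0 within {0..\<tau>})"
    "\<And>t. t \<in> {0..\<tau>} \<Longrightarrow> \<exists>z. trajectory F t (x t) z \<and> z t = x0"
proof -
  define Q where "Q = cball x0 1"
  define \<pi> where "\<pi> = closest_point Q"
  have Q: "convex Q" "closed Q" "Q \<noteq> {}" "compact Q" "x0 \<in> Q" by (auto simp: Q_def)
  have \<pi>: "\<pi> x \<in> Q" for x unfolding \<pi>_def using Q by (intro closest_point_in_set)
  have \<pi>_id: "\<pi> x = x" if "x \<in> Q" for x unfolding \<pi>_def using that by (rule closest_point_self)
  have F1: "F x \<noteq> {}" "convex (F x)" "compact (F x)" for x
    using F unfolding assumption_F_def F1_def by blast+
  obtain L where L: "L > 0"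
    "\<And>x y v. x \<in> Q \<Longrightarrow> y \<in> Q \<Longrightarrow> v \<in> F x \<Longrightarrow> \<exists>u\<in>F y. norm (u - v) \<le> L * norm (y - x)"
    using F2D[of F Q] F Q(4) unfolding assumption_F_def by blast
  \<comment> \<open>Composing with the projection onto \<open>Q\<close> turns the local Lipschitz condition into a global one.\<close>
  define G where "G x = uminus ` F (\<pi> x)" for x
  interpret lipschitz_multifunction G L
  proof
    fix x y v
    show "convex (G x)" unfolding G_def by (intro convex_negations F1)
    show "closed (G x)" unfolding G_def by (intro closed_negations compact_imp_closed F1)
    show "G x \<noteq> {}" unfolding G_def using F1 by simp
    show "0 \<le> L" using L by simp
    assume "v \<in> G x"
    then have "- v \<in> F (\<pi> x)" by (auto simp: G_def)
    then obtain u where u: "u \<in> F (\<pi> y)" "norm (u - - v) \<le> L * norm (\<pi> y - \<pi> x)"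
      using L(2) \<pi> by blast
    have "norm (\<pi> y - \<pi> x) \<le> norm (y - x)"
      unfolding \<pi>_def dist_norm[symmetric] by (rule closest_point_lipschitz[OF Q(1-3)])
    then have "L * norm (\<pi> y - \<pi> x) \<le> L * norm (y - x)" using L(1) by simp
    moreover have "norm (- u - v) = norm (u - - v)"
      by (metis minus_add_distrib norm_minus_cancel diff_minus_eq_add uminus_add_conv_diff add.commute)
    ultimately have "norm (- u - v) \<le> L * norm (y - x)" using u(2) by linarith
    then show "\<exists>u\<in>G y. norm (u - v) \<le> L * norm (y - x)" using u(1) by (auto simp: G_def)
  qed
  define T where "T = 1 / (2 * L)"
  have T: "L * T \<le> 1/2" "0 \<le> T" "0 < T" using L(1) by (auto simp: T_def)
  have "- v \<in> G x0" using v \<pi>_id[OF Q(5)] by (simp add: G_def)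
  from ex_C1_solution[OF this T(1,2)] obtain w where w: "continuous_on {0..T} w" "w 0 = - v"
    "\<And>t. t \<in> {0..T} \<Longrightarrow> w t \<in> G (x0 + integral {0..t} w)" by blast
  define x where "x t = x0 + integral {0..t} w" for t
  have "bounded (w ` {0..T})" by (intro compact_imp_bounded compact_continuous_image w(1)) simp
  then obtain B where B: "B > 0" "\<And>t. t \<in> {0..T} \<Longrightarrow> norm (w t) \<le> B" by (auto simp: bounded_pos)
  \<comment> \<open>The cap \<open>1 / B\<close> keeps the solution inside \<open>Q\<close>, where
    the projection is the identity and \<open>G\<close> consists of the negatives of
    \<open>F\<close>.\<close>
  define \<tau> where "\<tau> = min T (1 / B)"
  have \<tau>: "\<tau> > 0" "\<tau> \<le> T" "B * \<tau> \<le> 1" using T B(1) by (auto simp: \<tau>_def min_def field_simps)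
  have der: "(x has_vector_derivative w t) (at t within {0..T})" if "t \<in> {0..T}" for t
    unfolding x_def using integral_has_vector_derivative[OF w(1) that]
    by (auto intro!: derivative_eq_intros)
  have in_Q: "x t \<in> Q" if t: "t \<in> {0..\<tau>}" for t
  proof -
    have "norm (integral {0..t} w) \<le> B * (t - 0)"
      by (intro integral_bound continuous_on_subset[OF w(1)] B(2)) (use t \<tau> in auto)
    also have "\<dots> \<le> B * \<tau>" using t B(1) by simp
    finally show ?thesis using \<tau>(3) by (simp add: Q_def x_def dist_norm)
  qed
  have wF: "- w t \<in> F (x t)" if t: "t \<in> {0..\<tau>}" for t
    using w(3)[of t] t \<tau>(2) \<pi>_id[OF in_Q[OF t]] by (auto simp: G_def x_def)
  show ?thesis
  proof (rule that[OF \<tau>(1)])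
    show "x 0 = x0" by (simp add: x_def)
    show "(x has_vector_derivative - v) (at 0 within {0..\<tau>})"
      using der[of 0] w(2) T(2) \<tau>(2) by (auto intro: has_vector_derivative_within_subset)
    fix t assume t: "t \<in> {0..\<tau>}"
    \<comment> \<open>The start is written \<open>t - 0\<close> to match the \<open>x 0\<close> in
      \<open>trajectory_C1I\<close>.\<close>
    have "trajectory F t (x (t - 0)) (\<lambda>s. x (t - s))"
    proof (rule trajectory_C1I[where w="\<lambda>s. - w (t - s)" and M=B])
      fix s assume s: "s \<in> {0..t}"
      have "(x has_vector_derivative w (t - s)) (at (t - s) within (\<lambda>s. t - s) ` {0..t})"
        using der[of "t - s"] s t \<tau>(2) by (auto intro: has_vector_derivative_within_subset)
      moreover have "((\<lambda>s. t - s) has_vector_derivative - 1) (at s within {0..t})"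
        by (auto intro!: derivative_eq_intros simp: has_vector_derivative_def)
      ultimately show "((\<lambda>s. x (t - s)) has_vector_derivative - w (t - s)) (at s within {0..t})"
        using vector_diff_chain_within[of "\<lambda>s. t - s" "- 1" s "{0..t}" x "w (t - s)"] by (simp add: o_def)
      show "- w (t - s) \<in> F (x (t - s))" using wF s t by auto
      show "norm (- w (t - s)) \<le> B" using B(2)[of "t - s"] s t \<tau>(2) by auto
    qed (use B in auto)
    then show "\<exists>z. trajectory F t (x t) z \<and> z t = x0"
      by (intro exI[of _ "\<lambda>s. x (t - s)"]) (simp add: x_def)
  qed
qed

subsection \<open>Dynamic programming\<close>

text \<open>The definition admits only positive times off the target; \<open>T = 0\<close> is
  allowed here because then \<open>y = x T\<close> lies in \<open>K\<close>.\<close>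

lemma min_time_le:
  assumes "trajectory F T y x" "x T \<in> K" "0 \<le> T"
  shows "min_time F K y \<le> ereal T"
proof (cases "y \<in> K")
  case False
  have "x 0 = y" using assms(1) by (simp add: trajectory_def)
  then have "T > 0" using False assms(2,3) by (metis order_le_less)
  then show ?thesis using False assms unfolding min_time_def by (auto intro!: Inf_lower)
qed (use assms(3) in \<open>simp add: min_time_def\<close>)

lemma min_time_nonneg: "0 \<le> min_time F K y"
  unfolding min_time_def by (auto intro!: Inf_greatest)

text \<open>The interval is a single point, hence negligible, and the inclusion is vacuous. This
  treats starting points in \<open>K\<close> and outside it alike.\<close>

lemma trajectory_trivial: "trajectory F 0 y (\<lambda>_. y)"
proof -
  have "absolutely_continuous_fun_on {0..0} (\<lambda>_. y)"
    by (rule lipschitz_on_imp_absolutely_continuous_fun_on[of 0]) (simp add: lipschitz_on_def)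
  then show ?thesis unfolding trajectory_iff by (intro conjI exI[of _ "{0}"]) auto
qed

lemma min_time_lessE:
  assumes "min_time F K y < ereal \<beta>"
  obtains T x where "0 \<le> T" "T < \<beta>" "trajectory F T y x" "x T \<in> K"
proof (cases "y \<in> K")
  case True
  then show ?thesis using assms that[OF _ _ trajectory_trivial] by (simp add: min_time_def)
next
  case False
  then have "\<exists>T x. 0 < T \<and> T < \<beta> \<and> trajectory F T y x \<and> x T \<in> K"
    using assms unfolding min_time_def by (auto simp: Inf_less_iff)
  then show ?thesis using that by (meson less_imp_le)
qed

text \<open>Joins \<open>w\<close> to a trajectory from \<open>w s\<close> that is optimal up to
  \<open>e\<close>, then lets \<open>e\<close> tend to 0, so that the infimum need not be
  attained.\<close>

lemma min_time_prepend:
  assumes w: "trajectory F s y w" "0 \<le> s" and r: "min_time F K (w s) = ereal r"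
  shows "min_time F K y \<le> ereal (s + r)"
proof (rule ereal_le_epsilon2)
  fix e :: real assume "0 < e"
  then have "min_time F K (w s) < ereal (r + e)" using r by simp
  then obtain T x where x: "0 \<le> T" "T < r + e" "trajectory F T (w s) x" "x T \<in> K"
    by (rule min_time_lessE)
  have x0: "x 0 = w s" using x(3) by (simp add: trajectory_def)
  have "min_time F K y \<le> ereal (s + T)"
    by (rule min_time_le[OF trajectory_append[OF w(1) x(3) w(2) x(1)]]) (use x x0 w(2) in auto)
  also have "\<dots> \<le> ereal (s + r) + ereal e" using x(2) by simp
  finally show "min_time F K y \<le> ereal (s + r) + ereal e" .
qed

lemma min_time_along_trajectory:
  assumes "trajectory F T y x" "x T \<in> K" "0 \<le> s" "s \<le> T"
  shows "min_time F K (x s) \<le> ereal (T - s)"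
  using min_time_le[OF trajectory_drop[OF assms(1,3,4)]] assms by simp

lemma min_hamiltonian_le: "F1 F \<Longrightarrow> v \<in> F x \<Longrightarrow> min_hamiltonian F x \<zeta> \<le> v \<bullet> \<zeta>"
  using min_hamiltonian_is_minimum by metis

subsection \<open>Local estimates\<close>

text \<open>Constants uniform over starting points near \<open>x0\<close> and over short times.
  Linear growth bounds the speed. By the Lipschitz condition every velocity met on the way is close
  to some \<open>u \<in> F x0\<close>, for which \<open>u \<bullet> \<zeta>\<close> is at least the
  Hamiltonian at \<open>x0\<close>.\<close>

lemma trajectory_local_estimates:
  fixes F :: "'a::euclidean_space \<Rightarrow> 'a set"
  assumes F: "assumption_F F"
  obtains M L \<delta> where "M > 0" "L > 0" "\<delta> > 0"
    "\<And>y T x. norm (y - x0) \<le> 1 \<Longrightarrow> trajectory F T y x \<Longrightarrow> 0 \<le> T \<Longrightarrow> T \<le> \<delta> \<Longrightarrow> norm (x T - y) \<le> M * T"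
    "\<And>y T x \<zeta>. norm (y - x0) \<le> 1 \<Longrightarrow> trajectory F T y x \<Longrightarrow> 0 \<le> T \<Longrightarrow> T \<le> \<delta> \<Longrightarrow>
       T * (min_hamiltonian F x0 \<zeta> - L * norm \<zeta> * (norm (y - x0) + M * T)) \<le> (x T - y) \<bullet> \<zeta>"
proof -
  have F123: "F1 F" "F2 F" "F3 F" using F by (auto simp: assumption_F_def)
  obtain \<gamma> where \<gamma>: "\<gamma> > 0" "\<And>x v. v \<in> F x \<Longrightarrow> norm v \<le> \<gamma> * (1 + norm x)"
    using F123(3) unfolding F3_def by blast
  obtain L where L: "L > 0" "\<And>x y v. x \<in> cball x0 2 \<Longrightarrow> y \<in> cball x0 2 \<Longrightarrow> v \<in> F x \<Longrightarrow>
      \<exists>u\<in>F y. norm (u - v) \<le> L * norm (y - x)"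
    using F2D[OF F123(2) compact_cball] by blast
  \<comment> \<open>On the ball of radius 2 about \<open>x0\<close> the norm is at most
    \<open>2 + norm x0\<close>. Below, \<open>\<delta>\<close> is chosen so that a trajectory
    started within distance 1 of \<open>x0\<close> stays in that ball.\<close>
  define M where "M = \<gamma> * (3 + norm x0)"
  have M: "M > 0" unfolding M_def using \<gamma>(1) by (intro mult_pos_pos add_pos_nonneg) auto
  define \<delta> where "\<delta> = 1 / (2 * M)"
  have \<delta>: "\<delta> > 0" "M * \<delta> < 1" using M by (auto simp: \<delta>_def)
  have speed: "norm (x t - y) \<le> M * t"
    if y: "norm (y - x0) \<le> 1" and x: "trajectory F T y x" and T: "0 \<le> T" "T \<le> \<delta>" and t: "t \<in> {0..T}"
    for y T x t
  proof (rule trajectory_local_speed[OF x T(1) _ _ _ t, where \<rho>=1])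
    have "M * T \<le> M * \<delta>" using T M by simp
    then show "M * T < 1" using \<delta>(2) by simp
    fix z v assume z: "norm (z - y) < 1" "v \<in> F z"
    have "norm z \<le> 2 + norm x0"
      using norm_triangle_ineq[of "z - y" "y - x0"] norm_triangle_ineq[of "z - x0" x0] z(1) y by simp
    then have "\<gamma> * (1 + norm z) \<le> M" unfolding M_def using \<gamma>(1) by (intro mult_left_mono) auto
    then show "norm v \<le> M" using \<gamma>(2)[OF z(2)] by simp
  qed (use M in simp)
  show ?thesis
  proof (rule that[OF M L(1) \<delta>(1)])
    show "norm (x T - y) \<le> M * T" if "norm (y - x0) \<le> 1" "trajectory F T y x" "0 \<le> T" "T \<le> \<delta>" for y T x
      using speed[OF that, of T] that(3) by simp
    fix y T x \<zeta> assume A: "norm (y - x0) \<le> 1" "trajectory F T y x" "0 \<le> T" "T \<le> \<delta>"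
    have "(min_hamiltonian F x0 \<zeta> - L * norm \<zeta> * (norm (y - x0) + M * T)) * T \<le> (x T - y) \<bullet> \<zeta>"
    proof (rule trajectory_inner_ge[OF A(2,3)])
      fix t v assume t: "0 \<le> t" "t < T" "v \<in> F (x t)"
      have "norm (x t - y) \<le> M * t" using speed[OF A, of t] t by simp
      also have "\<dots> \<le> M * T" using t M by simp
      finally have "norm (x t - y) \<le> M * T" .
      then have near: "norm (x t - x0) \<le> norm (y - x0) + M * T"
        using norm_triangle_ineq[of "x t - y" "y - x0"] by simp
      have "M * T \<le> M * \<delta>" using A(4) M by simp
      then have "x t \<in> cball x0 2" using near A(1) \<delta>(2) by (simp add: dist_norm norm_minus_commute)
      then obtain u where u: "u \<in> F x0" "norm (u - v) \<le> L * norm (x0 - x t)"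
        using L(2)[of "x t" x0 v] t(3) by auto
      have "(u - v) \<bullet> \<zeta> \<le> norm (u - v) * norm \<zeta>" by (rule norm_cauchy_schwarz)
      also have "\<dots> \<le> (L * (norm (y - x0) + M * T)) * norm \<zeta>"
      proof (rule mult_right_mono)
        have "L * norm (x0 - x t) \<le> L * (norm (y - x0) + M * T)"
          using near L(1) by (simp add: norm_minus_commute)
        then show "norm (u - v) \<le> L * (norm (y - x0) + M * T)" using u(2) by simp
      qed simp
      finally show "min_hamiltonian F x0 \<zeta> - L * norm \<zeta> * (norm (y - x0) + M * T) \<le> v \<bullet> \<zeta>"
        using min_hamiltonian_le[OF F123(1) u(1), of \<zeta>] by (simp add: inner_diff_left mult_ac)
    qed
    then show "T * (min_hamiltonian F x0 \<zeta> - L * norm \<zeta> * (norm (y - x0) + M * T)) \<le> (x T - y) \<bullet> \<zeta>"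
      by (simp add: mult.commute)
  qed
qed

text \<open>Bounded speed forbids reaching a closed set at positive distance in arbitrarily short
  time. Hence the sublevel set at level 0 is \<open>K\<close>, and the minimum time is positive off
  \<open>K\<close>.\<close>

lemma min_time_le_0_iff:
  fixes F :: "'a::euclidean_space \<Rightarrow> 'a set"
  assumes F: "assumption_F F" and "closed K"
  shows "min_time F K y \<le> 0 \<longleftrightarrow> y \<in> K"
proof
  assume le: "min_time F K y \<le> 0"
  show "y \<in> K"
  proof (rule ccontr)
    assume "y \<notin> K"
    then obtain \<rho> where \<rho>: "\<rho> > 0" "ball y \<rho> \<subseteq> - K"
      using \<open>closed K\<close> by (metis ComplI closed_def open_contains_ball)
    obtain M L \<delta> where M: "M > 0" "\<delta> > 0" and speed: "\<And>z T x. norm (z - y) \<le> 1 \<Longrightarrow> trajectory F T z x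
        \<Longrightarrow> 0 \<le> T \<Longrightarrow> T \<le> \<delta> \<Longrightarrow> norm (x T - z) \<le> M * T"
      by (rule trajectory_local_estimates[OF F, of y]) blast
    have "0 < min \<delta> (\<rho> / M)" using M \<rho>(1) by simp
    then have "min_time F K y < ereal (min \<delta> (\<rho> / M))" using le by (meson ereal_less(2) order_le_less_trans)
    then obtain T x where x: "0 \<le> T" "T < min \<delta> (\<rho> / M)" "trajectory F T y x" "x T \<in> K"
      by (rule min_time_lessE)
    have "norm (x T - y) \<le> M * T" using speed[of y T x] x by simp
    also have "\<dots> < \<rho>" using x(2) M(1) by (simp add: field_simps)
    finally have "x T \<in> ball y \<rho>" by (simp add: dist_norm norm_minus_commute)
    then show False using \<rho>(2) x(4) by blast
  qed
qed (simp add: min_time_def)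

subsection \<open>The horizontal subdifferential\<close>

text \<open>The vertical component of the normal is 0, so \<open>\<beta>\<close> enters only through
  the squared distance; finiteness of \<open>f y\<close> follows from the real bound
  \<open>\<beta>\<close>.\<close>

lemma horizontal_proximal_subdifferential_iff:
  assumes "f x0 = ereal r"
  shows "\<zeta> \<in> horizontal_proximal_subdifferential f x0 \<longleftrightarrow>
    (\<exists>\<sigma>\<ge>0. \<forall>y \<beta>. f y \<le> ereal \<beta> \<longrightarrow> \<zeta> \<bullet> (y - x0) \<le> \<sigma> * ((norm (y - x0))\<^sup>2 + (\<beta> - r)\<^sup>2))"
proof -
  have "(y, \<beta>) \<in> epi f \<longleftrightarrow> f y \<le> ereal \<beta>" for y \<beta>
    by (auto simp: epi_def intro: le_less_trans)
  then have "(\<forall>p\<in>epi f. P p) \<longleftrightarrow> (\<forall>y \<beta>. f y \<le> ereal \<beta> \<longrightarrow> P (y, \<beta>))" for P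
    by (metis surj_pair)
  then show ?thesis
    using assms by (simp add: horizontal_proximal_subdifferential_def proximal_normal_cone_def norm_Pair)
qed

lemma horizontal_subdifferential_subset_normal_cone:
  assumes r: "min_time F K x0 = ereal r"
    and \<zeta>: "\<zeta> \<in> horizontal_proximal_subdifferential (min_time F K) x0"
  shows "\<zeta> \<in> proximal_normal_cone (reachable_within F K (ereal r)) x0"
proof -
  obtain \<sigma> where "\<sigma> \<ge> 0" and \<sigma>: "\<And>y \<beta>. min_time F K y \<le> ereal \<beta> \<Longrightarrow>
      \<zeta> \<bullet> (y - x0) \<le> \<sigma> * ((norm (y - x0))\<^sup>2 + (\<beta> - r)\<^sup>2)"
    using \<zeta> unfolding horizontal_proximal_subdifferential_iff[of "min_time F K", OF r] by blast
  have "\<forall>y\<in>reachable_within F K (ereal r). \<zeta> \<bullet> (y - x0) \<le> \<sigma> * (norm (y - x0))\<^sup>2"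
  proof
    fix y assume "y \<in> reachable_within F K (ereal r)"
    then show "\<zeta> \<bullet> (y - x0) \<le> \<sigma> * (norm (y - x0))\<^sup>2"
      using \<sigma>[of y r] by (simp add: reachable_within_def)
  qed
  then show ?thesis unfolding proximal_normal_cone_def using \<open>\<sigma> \<ge> 0\<close> by blast
qed

text \<open>Suppose \<open>v \<bullet> \<zeta> < 0\<close> for some \<open>v \<in> F x0\<close>.
  Points \<open>x t\<close> on the backward curve have minimum time at most \<open>t + r\<close>.
  Dividing the epigraph inequality by \<open>t\<close> and letting \<open>t\<close> tend to 0 gives
  \<open>\<zeta> \<bullet> (- v) \<le> 0\<close>, a contradiction.\<close>

lemma horizontal_subdifferential_hamiltonian_nonneg:
  fixes F :: "'a::euclidean_space \<Rightarrow> 'a set"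
  assumes F: "assumption_F F" and r: "min_time F K x0 = ereal r"
    and \<zeta>: "\<zeta> \<in> horizontal_proximal_subdifferential (min_time F K) x0"
  shows "0 \<le> min_hamiltonian F x0 \<zeta>"
proof (rule ccontr)
  assume neg: "\<not> 0 \<le> min_hamiltonian F x0 \<zeta>"
  obtain \<sigma> where \<sigma>0: "\<sigma> \<ge> 0" and \<sigma>: "\<And>y \<beta>. min_time F K y \<le> ereal \<beta> \<Longrightarrow>
      \<zeta> \<bullet> (y - x0) \<le> \<sigma> * ((norm (y - x0))\<^sup>2 + (\<beta> - r)\<^sup>2)"
    using \<zeta> unfolding horizontal_proximal_subdifferential_iff[of "min_time F K", OF r] by blast
  have "F1 F" using F by (simp add: assumption_F_def)
  then obtain v where v: "v \<in> F x0" "v \<bullet> \<zeta> < 0"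
    using neg min_hamiltonian_is_minimum[of F x0 \<zeta>] by auto
  obtain \<tau> x where \<tau>: "\<tau> > 0" "x 0 = x0" "(x has_vector_derivative - v) (at 0 within {0..\<tau>})"
    "\<And>t. t \<in> {0..\<tau>} \<Longrightarrow> \<exists>z. trajectory F t (x t) z \<and> z t = x0"
    using ex_C1_backward_trajectory[OF F v(1)] by blast
  have ineq: "\<zeta> \<bullet> (x t - x0) \<le> \<sigma> * ((norm (x t - x0))\<^sup>2 + t\<^sup>2)" if t: "t \<in> {0..\<tau>}" for t
  proof -
    obtain z where z: "trajectory F t (x t) z" "z t = x0" using \<tau>(4)[OF t] by blast
    have "min_time F K (x t) \<le> ereal (t + r)"
      by (rule min_time_prepend[OF z(1)]) (use t z(2) r in auto)
    then show ?thesis using \<sigma>[of "x t" "t + r"] by simp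
  qed
  define d where "d t = (1 / t) *\<^sub>R (x t - x0)" for t
  have "((\<lambda>t. (1 / norm (t - 0)) *\<^sub>R (x t - (x 0 + (t - 0) *\<^sub>R (- v)))) \<longlongrightarrow> 0) (at 0 within {0..\<tau>})"
    using \<tau>(3) unfolding has_vector_derivative_def has_derivative_within by blast
  moreover have "\<forall>\<^sub>F t in at 0 within {0..\<tau>}.
      (1 / norm (t - 0)) *\<^sub>R (x t - (x 0 + (t - 0) *\<^sub>R (- v))) = d t - (- v)"
    unfolding eventually_at_filter
    by (intro always_eventually allI impI) (use \<tau>(2) in \<open>auto simp: d_def algebra_simps\<close>)
  ultimately have "((\<lambda>t. d t - (- v)) \<longlongrightarrow> 0) (at 0 within {0..\<tau>})"
    by (rule Lim_transform_eventually)
  then have d: "(d \<longlongrightarrow> - v) (at 0 within {0..\<tau>})" by (rule LIM_zero_cancel)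
  have "((\<lambda>t. \<zeta> \<bullet> d t) \<longlongrightarrow> \<zeta> \<bullet> (- v)) (at 0 within {0..\<tau>})" by (intro tendsto_intros d)
  moreover have "((\<lambda>t. \<sigma> * t * ((norm (d t))\<^sup>2 + 1)) \<longlongrightarrow> \<sigma> * 0 * ((norm (- v))\<^sup>2 + 1)) (at 0 within {0..\<tau>})"
    by (intro tendsto_intros d)
  moreover have "\<forall>\<^sub>F t in at 0 within {0..\<tau>}. \<zeta> \<bullet> d t \<le> \<sigma> * t * ((norm (d t))\<^sup>2 + 1)"
    unfolding eventually_at_filter
  proof (intro always_eventually allI impI)
    fix t :: real assume t: "t \<noteq> 0" "t \<in> {0..\<tau>}"
    then have "t > 0" by simp
    have "t * (\<zeta> \<bullet> d t) = \<zeta> \<bullet> (x t - x0)" using t by (simp add: d_def)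
    also have "\<dots> \<le> \<sigma> * ((norm (t *\<^sub>R d t))\<^sup>2 + t\<^sup>2)" using ineq[OF t(2)] t(1) by (simp add: d_def)
    also have "\<dots> = t * (\<sigma> * t * ((norm (d t))\<^sup>2 + 1))"
      by (simp add: power2_eq_square algebra_simps)
    finally show "\<zeta> \<bullet> d t \<le> \<sigma> * t * ((norm (d t))\<^sup>2 + 1)" using \<open>t > 0\<close> by simp
  qed
  moreover have "at 0 within {0..\<tau>} \<noteq> bot"
    using \<tau>(1) by (simp add: at_within_Icc_at_right)
  ultimately have "\<zeta> \<bullet> (- v) \<le> \<sigma> * 0 * ((norm (- v))\<^sup>2 + 1)" using tendsto_le by blast
  then show False using v(2) by (simp add: inner_commute)
qed

text \<open>Along a nearly optimal trajectory both the displacement and the change of height are of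
  order \<open>t\<close>, so the epigraph inequality bounds
  \<open>\<zeta> \<bullet> (x t - x0)\<close> above by a multiple of \<open>t\<^sup>2\<close>. The
  local estimate bounds it below by \<open>t\<close> times the Hamiltonian, up to the same
  order.\<close>

lemma horizontal_subdifferential_hamiltonian_nonpos:
  fixes F :: "'a::euclidean_space \<Rightarrow> 'a set"
  assumes F: "assumption_F F" and r: "min_time F K x0 = ereal r" "r > 0"
    and \<zeta>: "\<zeta> \<in> horizontal_proximal_subdifferential (min_time F K) x0"
  shows "min_hamiltonian F x0 \<zeta> \<le> 0"
proof -
  obtain \<sigma> where \<sigma>0: "\<sigma> \<ge> 0" and \<sigma>: "\<And>y \<beta>. min_time F K y \<le> ereal \<beta> \<Longrightarrow>
      \<zeta> \<bullet> (y - x0) \<le> \<sigma> * ((norm (y - x0))\<^sup>2 + (\<beta> - r)\<^sup>2)"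
    using \<zeta> unfolding horizontal_proximal_subdifferential_iff[of "min_time F K", OF r(1)] by blast
  obtain M L \<delta> where M: "M > 0" "L > 0" "\<delta> > 0"
    and speed: "\<And>y T x. norm (y - x0) \<le> 1 \<Longrightarrow> trajectory F T y x \<Longrightarrow> 0 \<le> T \<Longrightarrow> T \<le> \<delta> \<Longrightarrow> norm (x T - y) \<le> M * T"
    and inner: "\<And>y T x \<zeta>. norm (y - x0) \<le> 1 \<Longrightarrow> trajectory F T y x \<Longrightarrow> 0 \<le> T \<Longrightarrow> T \<le> \<delta> \<Longrightarrow>
       T * (min_hamiltonian F x0 \<zeta> - L * norm \<zeta> * (norm (y - x0) + M * T)) \<le> (x T - y) \<bullet> \<zeta>"
    by (rule trajectory_local_estimates[OF F, of x0]) blast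
  define C where "C = L * norm \<zeta> * M + \<sigma> * (M\<^sup>2 + 1)"
  have bound: "min_hamiltonian F x0 \<zeta> \<le> C * t" if t: "0 < t" "t \<le> \<delta>" "t < r" "t \<le> 1" for t
  proof -
    have "min_time F K x0 < ereal (r + t\<^sup>2)" using r(1) t(1) by simp
    then obtain T x where x: "0 \<le> T" "T < r + t\<^sup>2" "trajectory F T x0 x" "x T \<in> K"
      by (rule min_time_lessE)
    \<comment> \<open>Since \<open>t < r\<close>, the trajectory has not ended at time
      \<open>t\<close> and can be cut there.\<close>
    have "r \<le> T" using min_time_le[OF x(3,4,1)] r(1) by simp
    then have tT: "t \<le> T" using t(3) by simp
    have xt: "trajectory F t x0 x" using trajectory_take[OF x(3) tT] .
    have "min_time F K (x t) \<le> ereal (T - t)"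
      using min_time_along_trajectory[OF x(3,4) _ tT] t(1) by simp
    also have "\<dots> \<le> ereal (r + t\<^sup>2 - t)" using x(2) by simp
    finally have "\<zeta> \<bullet> (x t - x0) \<le> \<sigma> * ((norm (x t - x0))\<^sup>2 + (r + t\<^sup>2 - t - r)\<^sup>2)" by (rule \<sigma>)
    also have "\<dots> \<le> \<sigma> * ((M * t)\<^sup>2 + t\<^sup>2)"
    proof (intro mult_left_mono add_mono \<sigma>0)
      show "(norm (x t - x0))\<^sup>2 \<le> (M * t)\<^sup>2" using speed[OF _ xt] t by (intro power_mono) auto
      have "t\<^sup>2 \<le> t" using t by (simp add: power2_eq_square mult_left_le)
      then have "\<bar>r + t\<^sup>2 - t - r\<bar> \<le> \<bar>t\<bar>" using t by simp
      then show "(r + t\<^sup>2 - t - r)\<^sup>2 \<le> t\<^sup>2" by (simp only: abs_le_square_iff)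
    qed
    also have "\<dots> = t * (\<sigma> * (M\<^sup>2 + 1) * t)" by (simp add: power2_eq_square algebra_simps)
    finally have "(x t - x0) \<bullet> \<zeta> \<le> t * (\<sigma> * (M\<^sup>2 + 1) * t)" by (simp add: inner_commute)
    moreover have "t * (min_hamiltonian F x0 \<zeta> - L * norm \<zeta> * (M * t)) \<le> (x t - x0) \<bullet> \<zeta>"
      using inner[OF _ xt, of \<zeta>] t by simp
    ultimately have "t * (min_hamiltonian F x0 \<zeta> - L * norm \<zeta> * (M * t)) \<le> t * (\<sigma> * (M\<^sup>2 + 1) * t)"
      by linarith
    then have "min_hamiltonian F x0 \<zeta> - L * norm \<zeta> * (M * t) \<le> \<sigma> * (M\<^sup>2 + 1) * t"
      using t(1) by (simp only: mult_le_cancel_left_pos)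
    then show ?thesis by (simp add: C_def algebra_simps)
  qed
  have "((\<lambda>t. C * t) \<longlongrightarrow> C * 0) (at_right 0)" by (intro tendsto_intros)
  moreover have "\<forall>\<^sub>F t in at_right 0. min_hamiltonian F x0 \<zeta> \<le> C * t"
    unfolding eventually_at_right_field
    using M(3) r(2) by (intro exI[of _ "min \<delta> (min r 1)"]) (auto intro: bound)
  ultimately have "min_hamiltonian F x0 \<zeta> \<le> C * 0" by (intro tendsto_lowerbound) auto
  then show ?thesis by simp
qed

text \<open>Far from \<open>(x0, r)\<close> Cauchy-Schwarz suffices, and inside the sublevel set
  normality does. The remaining \<open>y\<close> are steered into the sublevel set; normality is
  used at the entry point, and \<open>h\<close> controls the way there.\<close>

lemma normal_cone_hamiltonian_subset_horizontal_subdifferential: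
  fixes F :: "'a::euclidean_space \<Rightarrow> 'a set"
  assumes F: "assumption_F F" and r: "min_time F K x0 = ereal r"
    and \<zeta>: "\<zeta> \<in> proximal_normal_cone (reachable_within F K (ereal r)) x0"
    and h: "0 \<le> min_hamiltonian F x0 \<zeta>"
  shows "\<zeta> \<in> horizontal_proximal_subdifferential (min_time F K) x0"
proof -
  obtain \<sigma> where \<sigma>0: "\<sigma> \<ge> 0"
    and \<sigma>: "\<And>y. min_time F K y \<le> ereal r \<Longrightarrow> \<zeta> \<bullet> (y - x0) \<le> \<sigma> * (norm (y - x0))\<^sup>2"
    using \<zeta> unfolding proximal_normal_cone_def reachable_within_def by blast
  obtain M L \<delta> where M: "M > 0" "L > 0" "\<delta> > 0"
    and speed: "\<And>y T x. norm (y - x0) \<le> 1 \<Longrightarrow> trajectory F T y x \<Longrightarrow> 0 \<le> T \<Longrightarrow> T \<le> \<delta> \<Longrightarrow> norm (x T - y) \<le> M * T"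
    and inner: "\<And>y T x \<zeta>. norm (y - x0) \<le> 1 \<Longrightarrow> trajectory F T y x \<Longrightarrow> 0 \<le> T \<Longrightarrow> T \<le> \<delta> \<Longrightarrow>
       T * (min_hamiltonian F x0 \<zeta> - L * norm \<zeta> * (norm (y - x0) + M * T)) \<le> (x T - y) \<bullet> \<zeta>"
    by (rule trajectory_local_estimates[OF F, of x0]) blast
  \<comment> \<open>In the near case the steering time is below \<open>2 * \<epsilon>\<close>; the
    factor 1/2 keeps it within \<open>\<delta>\<close>.\<close>
  define \<epsilon> where "\<epsilon> = min \<delta> 1 / 2"
  have \<epsilon>: "\<epsilon> > 0" "2 * \<epsilon> \<le> \<delta>" "\<epsilon> \<le> 1" using M(3) by (auto simp: \<epsilon>_def)
  define A where "A = \<sigma> + L * norm \<zeta> / M"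
  have A: "A \<ge> \<sigma>" "A \<ge> 0" using \<sigma>0 M by (auto simp: A_def)
  \<comment> \<open>The first summand serves the near case, the second the far one.\<close>
  define C where "C = 2 * A * (1 + 4 * M\<^sup>2) + norm \<zeta> / \<epsilon>"
  have MM: "1 + 4 * M\<^sup>2 \<ge> 1" by simp
  have CA: "2 * A * (1 + 4 * M\<^sup>2) \<le> C" using \<epsilon>(1) by (simp add: C_def)
  have "2 * A * 1 \<le> 2 * A * (1 + 4 * M\<^sup>2)" using A(2) by (intro mult_left_mono) auto
  then have C\<sigma>: "\<sigma> \<le> C" using CA A by linarith
  have C\<epsilon>: "norm \<zeta> / \<epsilon> \<le> C" using A(2) MM by (simp add: C_def)
  have C0: "C \<ge> 0" using C\<sigma> \<sigma>0 by simp
  have main: "\<zeta> \<bullet> (y - x0) \<le> C * ((norm (y - x0))\<^sup>2 + (\<beta> - r)\<^sup>2)" if y: "min_time F K y \<le> ereal \<beta>" for y \<beta>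
  proof -
    let ?u = "norm (y - x0)"
    \<comment> \<open>Here \<open>a\<close> stands for whichever of \<open>norm (y - x0)\<close> and
      \<open>\<beta> - r\<close> is at least \<open>\<epsilon>\<close>; then
      \<open>a \<le> a\<^sup>2 / \<epsilon>\<close> turns a linear bound into a quadratic
      one.\<close>
    have far: ?thesis if a: "\<epsilon> \<le> a" "?u \<le> a" "a\<^sup>2 \<le> ?u\<^sup>2 + (\<beta> - r)\<^sup>2" for a
    proof -
      have "\<zeta> \<bullet> (y - x0) \<le> norm \<zeta> * a"
        using norm_cauchy_schwarz[of \<zeta> "y - x0"] mult_left_mono[OF a(2) norm_ge_zero[of \<zeta>]] by linarith
      also have "\<dots> \<le> norm \<zeta> / \<epsilon> * a\<^sup>2"
      proof -
        have "norm \<zeta> / \<epsilon> * (\<epsilon> * a) \<le> norm \<zeta> / \<epsilon> * (a * a)"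
          using a(1) \<epsilon>(1) by (intro mult_left_mono mult_right_mono) auto
        then show ?thesis using \<epsilon>(1) by (simp add: power2_eq_square)
      qed
      also have "\<dots> \<le> C * (?u\<^sup>2 + (\<beta> - r)\<^sup>2)" using C\<epsilon> C0 a(3) by (intro mult_mono) auto
      finally show ?thesis .
    qed
    have inR: ?thesis if "min_time F K y \<le> ereal r"
    proof -
      have "\<zeta> \<bullet> (y - x0) \<le> \<sigma> * ?u\<^sup>2" using \<sigma>[OF that] .
      also have "\<dots> \<le> C * (?u\<^sup>2 + (\<beta> - r)\<^sup>2)" using C\<sigma> C0 by (intro mult_mono) auto
      finally show ?thesis .
    qed
    consider "\<epsilon> \<le> ?u" | "?u < \<epsilon>" "\<epsilon> \<le> \<beta> - r" | "\<beta> \<le> r" | "?u < \<epsilon>" "0 < \<beta> - r" "\<beta> - r < \<epsilon>"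
      by linarith
    then show ?thesis
    proof cases
      case 1 then show ?thesis by (intro far[of ?u]) auto
    next
      case 2 then show ?thesis by (intro far[of "\<beta> - r"]) auto
    next
      case 3
      then have "min_time F K y \<le> ereal r" using y by (meson ereal_less_eq(3) order_trans)
      then show ?thesis by (rule inR)
    next
      case 4
      define \<tau> where "\<tau> = \<beta> - r"
      \<comment> \<open>Allowing a slack of \<open>\<tau>\<close> keeps the excess of
        \<open>T\<close> over \<open>r\<close> below \<open>2 * \<tau>\<close>.\<close>
      have "min_time F K y < ereal (\<beta> + \<tau>)" using y 4(2) by (auto simp: \<tau>_def intro: le_less_trans)
      then obtain T x where x: "0 \<le> T" "T < \<beta> + \<tau>" "trajectory F T y x" "x T \<in> K"
        by (rule min_time_lessE)
      show ?thesis
      proof (cases "T \<le> r")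
        case True
        then show ?thesis using min_time_le[OF x(3,4,1)] by (intro inR) (auto intro: order_trans)
      next
        case False
        have r0: "r \<ge> 0" using min_time_nonneg[of F K x0] r by simp
        \<comment> \<open>After time \<open>s\<close> exactly \<open>r\<close> is left, so
          \<open>x s\<close> is in the sublevel set.\<close>
        define s where "s = T - r"
        have s: "0 \<le> s" "s \<le> T" "s \<le> 2 * \<tau>" "s \<le> \<delta>"
          using False r0 x(2) 4 \<epsilon>(2) by (auto simp: s_def \<tau>_def)
        have xs: "trajectory F s y x" using trajectory_take[OF x(3) s(2)] .
        have y1: "?u \<le> 1" using 4(1) \<epsilon>(3) by simp
        define a where "a = ?u + M * s"
        have a0: "a \<ge> 0" using s(1) M(1) by (simp add: a_def)
        have "norm (x s - x0) \<le> a"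
          using speed[OF y1 xs s(1,4)] norm_triangle_ineq[of "x s - y" "y - x0"] by (simp add: a_def)
        then have "\<sigma> * (norm (x s - x0))\<^sup>2 \<le> \<sigma> * a\<^sup>2" using \<sigma>0 by (intro mult_left_mono power_mono) auto
        moreover have "min_time F K (x s) \<le> ereal r"
          using min_time_along_trajectory[OF x(3,4) s(1,2)] by (simp add: s_def)
        ultimately have 1: "\<zeta> \<bullet> (x s - x0) \<le> \<sigma> * a\<^sup>2" using \<sigma> by fastforce
        have "s * (min_hamiltonian F x0 \<zeta> - L * norm \<zeta> * a) \<le> (x s - y) \<bullet> \<zeta>"
          unfolding a_def by (rule inner[OF y1 xs s(1,4)])
        moreover have "s * min_hamiltonian F x0 \<zeta> \<ge> 0" using s(1) h by simp
        ultimately have "- (L * norm \<zeta> * (s * a)) \<le> \<zeta> \<bullet> (x s - y)"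
          by (simp add: inner_commute algebra_simps)
        \<comment> \<open>Since \<open>M * s \<le> a\<close>, the error made on the way is quadratic
          in \<open>a\<close> and merges with the normality term into
          \<open>A * a\<^sup>2\<close>.\<close>
        moreover have "L * norm \<zeta> * (s * a) \<le> L * norm \<zeta> * (a / M * a)"
        proof (intro mult_left_mono mult_right_mono a0)
          show "s \<le> a / M" using M(1) by (simp add: a_def field_simps)
        qed (use M in auto)
        moreover have "\<zeta> \<bullet> (y - x0) = \<zeta> \<bullet> (x s - x0) - \<zeta> \<bullet> (x s - y)" by (simp add: inner_diff_right)
        ultimately have "\<zeta> \<bullet> (y - x0) \<le> \<sigma> * a\<^sup>2 + L * norm \<zeta> * (a / M * a)" using 1 by linarith
        also have "\<dots> = A * a\<^sup>2" by (simp add: A_def power2_eq_square algebra_simps)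
        also have "\<dots> \<le> A * (2 * (1 + 4 * M\<^sup>2) * (?u\<^sup>2 + \<tau>\<^sup>2))"
        proof (intro mult_left_mono A)
          have "a\<^sup>2 \<le> 2 * ?u\<^sup>2 + 2 * (M * s)\<^sup>2"
            using zero_le_power2[of "?u - M * s"] by (simp add: a_def power2_eq_square algebra_simps)
          also have "\<dots> \<le> 2 * ?u\<^sup>2 + 2 * (M * (2 * \<tau>))\<^sup>2"
            using s M(1) by (intro add_left_mono mult_left_mono power_mono) auto
          also have "\<dots> = 2 * (?u\<^sup>2 + 4 * M\<^sup>2 * \<tau>\<^sup>2)" by (simp add: power_mult_distrib)
          also have "\<dots> \<le> 2 * (?u\<^sup>2 + 4 * M\<^sup>2 * \<tau>\<^sup>2 + (4 * M\<^sup>2 * ?u\<^sup>2 + \<tau>\<^sup>2))" by simp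
          also have "\<dots> = 2 * (1 + 4 * M\<^sup>2) * (?u\<^sup>2 + \<tau>\<^sup>2)" by (simp add: algebra_simps)
          finally show "a\<^sup>2 \<le> 2 * (1 + 4 * M\<^sup>2) * (?u\<^sup>2 + \<tau>\<^sup>2)" .
        qed
        also have "\<dots> = 2 * A * (1 + 4 * M\<^sup>2) * (?u\<^sup>2 + \<tau>\<^sup>2)" by simp
        also have "\<dots> \<le> C * (?u\<^sup>2 + \<tau>\<^sup>2)" by (intro mult_right_mono CA) simp
        finally show ?thesis by (simp add: \<tau>_def)
      qed
    qed
  qed
  then show ?thesis
    unfolding horizontal_proximal_subdifferential_iff[of "min_time F K", OF r] using C0 by blast
qed

section \<open>The two cases: points of the target and controllable points off it\<close>

theorem theorem3p2:
  fixes F :: "real ^ 'n \<Rightarrow> (real ^ 'n) set" and K :: "(real ^ 'n) set"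
  assumes "assumption_F F" and "closed K"
  shows "(\<forall>x0\<in>K. horizontal_proximal_subdifferential (min_time F K) x0 =
            proximal_normal_cone K x0 \<inter> {\<zeta>. min_hamiltonian F x0 \<zeta> \<ge> 0})
       \<and> (\<forall>x0\<in>controllable_set F K - K.
            horizontal_proximal_subdifferential (min_time F K) x0 =
            proximal_normal_cone (reachable_within F K (min_time F K x0)) x0
              \<inter> {\<zeta>. min_hamiltonian F x0 \<zeta> = 0})"
proof (intro conjI ballI)
  have sub: "horizontal_proximal_subdifferential (min_time F K) x0 =
      proximal_normal_cone (reachable_within F K (ereal r)) x0 \<inter> {\<zeta>. min_hamiltonian F x0 \<zeta> \<ge> 0}"
    if "min_time F K x0 = ereal r" for x0 r
    using horizontal_subdifferential_subset_normal_cone[OF that]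
      horizontal_subdifferential_hamiltonian_nonneg[OF assms(1) that]
      normal_cone_hamiltonian_subset_horizontal_subdifferential[OF assms(1) that] by blast
  {
    fix x0 assume "x0 \<in> K"
    moreover have "reachable_within F K (ereal 0) = K"
      using min_time_le_0_iff[OF assms] by (simp add: reachable_within_def zero_ereal_def)
    ultimately show "horizontal_proximal_subdifferential (min_time F K) x0 =
        proximal_normal_cone K x0 \<inter> {\<zeta>. min_hamiltonian F x0 \<zeta> \<ge> 0}"
      using sub[of x0 0] by (simp add: min_time_def zero_ereal_def)
  next
    fix x0 assume x0: "x0 \<in> controllable_set F K - K"
    then have "min_time F K x0 > 0" "min_time F K x0 < \<infinity>"
      using min_time_le_0_iff[OF assms, of x0] by (auto simp: controllable_set_def not_le[symmetric])
    then obtain r where r: "min_time F K x0 = ereal r" "r > 0" by (cases "min_time F K x0") auto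
    show "horizontal_proximal_subdifferential (min_time F K) x0 =
        proximal_normal_cone (reachable_within F K (min_time F K x0)) x0 \<inter> {\<zeta>. min_hamiltonian F x0 \<zeta> = 0}"
      using sub[OF r(1)] horizontal_subdifferential_hamiltonian_nonpos[OF assms(1) r] r(1) by force
  }
qed

end
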